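(* Let $t>0$ be an integer. There is a constant $C_t$ such that the following holds. Let $K$ be a Jordan curve, $V$ a set of $n\ge 2$ points on $K$, and $\mathcal L$ a set of pseudolines such that every pair of points of $V$ lies on a pseudoline of $\mathcal L$. If the curve pseudo-visibility graph $G=G_{\mathcal L}(K,V)$ does not contain $K_{t,t}$ as a subgraph, then (1) $G$ has at most $C_t n\log n$ edges, and (2) for all $A,B\subseteq V$ with $A<B$ (with respect to the clockwise cyclic order of $V$ along $K$), the number of edges $(a,b)$ of $G$ with $a\in A$ and $b\in B$ is at most $C_t(|A|+|B|)$.
   Context: A set of pseudolines is a family of unbounded simple curves in the plane, each homeomorphic to a line, any two of which intersect in exactly one point, at which they cross. The curve pseudo-visibility graph $G_{\mathcal L}(K,V)$ has vertex set $V$, and $u,v\in V$ are adjacent iff the part between $u$ and $v$ of the (unique) pseudoline of $\mathcal L$ through $u$ and $v$ is disjoint from the exterior of $K$. The points of $V$ are cyclically ordered clockwise along $K$. For a cyclic order and sets $A,B$, $A<B$ means there is an element $x$ such that, in the linear order obtained by cutting the cyclic order so that $x$ is smallest, every element of $A$ precedes every element of $B$ (equivalently, $A$ and $B$ occupy two disjoint arcs of the cyclic order). *)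

theory Defs
  imports "HOL-Analysis.Analysis"
begin

definition jordan_curve :: "(real \<Rightarrow> complex) \<Rightarrow> bool" where
  "jordan_curve K \<longleftrightarrow> simple_path K \<and> pathfinish K = pathstart K"

definition pseudoline :: "complex set \<Rightarrow> bool" where
  "pseudoline L \<longleftrightarrow> closed L \<and> \<not> bounded L \<and> L homeomorphic (UNIV :: real set)"

definition crosses_at :: "complex set \<Rightarrow> complex set \<Rightarrow> complex \<Rightarrow> bool" where
  "crosses_at L1 L2 p \<longleftrightarrow>
     (\<exists>g h. homeomorphism (UNIV :: real set) L2 g h \<and> g 0 = p \<and>
        \<not> connected_component (- L1) (g (-1)) (g 1))"

definition pseudoline_family :: "complex set set \<Rightarrow> bool" where
  "pseudoline_family \<L> \<longleftrightarrow>
     (\<forall>L\<in>\<L>. pseudoline L) \<and>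
     (\<forall>L1\<in>\<L>. \<forall>L2\<in>\<L>. L1 \<noteq> L2 \<longrightarrow>
        (\<exists>p. L1 \<inter> L2 = {p} \<and> crosses_at L1 L2 p \<and> crosses_at L2 L1 p))"

definition pl_arc :: "complex set \<Rightarrow> complex \<Rightarrow> complex \<Rightarrow> complex set" where
  "pl_arc L u v = (SOME S. \<exists>g h a b. homeomorphism (UNIV :: real set) L g h \<and>
        g a = u \<and> g b = v \<and> S = g ` closed_segment a b)"

definition cpv_adj :: "complex set set \<Rightarrow> (real \<Rightarrow> complex) \<Rightarrow> complex set
                        \<Rightarrow> complex \<Rightarrow> complex \<Rightarrow> bool" where
  "cpv_adj \<L> K V u v \<longleftrightarrow> u \<in> V \<and> v \<in> V \<and> u \<noteq> v \<and>
     (\<exists>L\<in>\<L>. u \<in> L \<and> v \<in> L \<and> pl_arc L u v \<inter> outside (path_image K) = {})"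

definition curve_pos :: "(real \<Rightarrow> complex) \<Rightarrow> complex \<Rightarrow> real" where
  "curve_pos K y = (SOME s. s \<in> {0..<1} \<and> K s = y)"

text \<open>A < B in the cyclic order of V along K: cutting the cyclic order at some x \<in> V
  (x becoming smallest), every element of A precedes every element of B.\<close>
definition cyc_less :: "(real \<Rightarrow> complex) \<Rightarrow> complex set \<Rightarrow> complex set \<Rightarrow> complex set \<Rightarrow> bool" where
  "cyc_less K V A B \<longleftrightarrow>
     (\<exists>x\<in>V. \<forall>a\<in>A. \<forall>b\<in>B.
        frac (curve_pos K a - curve_pos K x) < frac (curve_pos K b - curve_pos K x))"

definition contains_Ktt :: "('v \<Rightarrow> 'v \<Rightarrow> bool) \<Rightarrow> 'v set \<Rightarrow> nat \<Rightarrow> bool" where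
  "contains_Ktt E V t \<longleftrightarrow> (\<exists>S T. S \<subseteq> V \<and> T \<subseteq> V \<and> S \<inter> T = {} \<and>
      card S = t \<and> card T = t \<and> (\<forall>s\<in>S. \<forall>r\<in>T. E s r))"

definition num_edges :: "('v \<Rightarrow> 'v \<Rightarrow> bool) \<Rightarrow> nat" where
  "num_edges E = card {{u, v} | u v. E u v}"

end

theory Submission
  imports Defs
begin

text \<open>
  Write \<open>A < B\<close> as rows and columns of the adjacency matrix, in the order along \<open>K\<close>. The key fact is
  that an entry with ones on all four sides is itself a one, provided the five pseudolines involved
  are distinct: if \<open>u\<close> sees \<open>b1, b3\<close> and \<open>v\<close> sees \<open>a1, a3\<close>, the points being in cyclic
  order \<open>a1, u, a3, b1, v, b3\<close>, then the visible arcs \<open>u b3\<close> and \<open>a1 v\<close> meet, as do \<open>u b1\<close>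
  and \<open>a3 v\<close>, and this gives two arcs from \<open>u\<close> to \<open>v\<close> that bound a region in the closure of
  the inside of \<open>K\<close>. The arc of the pseudoline \<open>u v\<close> lies in this region, since otherwise one of
  the other pseudolines would be trapped in a triangle and could not escape to infinity. As many
  mutually visible collinear vertices form a clique, every entry with \<open>8 t\<close> ones on each of its four
  sides is therefore a one. All but linearly many ones of the matrix are thus crossings of horizontal
  and vertical segments. Cells of that arrangement are empty rectangles except for linearly many that
  can be charged to segment ends, so more than linearly many crossings produce a full \<open>t\<close> by \<open>t\<close> grid,
  which is a \<open>K\<^sub>t\<^sub>,\<^sub>t\<close>. The bound \<open>n log n\<close> follows by halving the vertex set.
\<close>

section \<open>Arcs in the closed region bounded by a Jordan curve\<close>

text \<open>Visibility forbids only the outside of \<open>K\<close>: an arc may run along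
  \<open>K\<close>, touch it in between, or meet another arc on it. Chords are therefore not
  crosscuts of the inside, and every separation is phrased with closed pieces of \<open>K\<close>
  and components of complements. The filling argument needs any two of its five pseudolines to meet
  at most once, and collinear vertices stand in the way. A line through \<open>u\<close> carries
  fewer than \<open>2 t\<close> neighbours of \<open>u\<close> on each side of \<open>u\<close>, so
  among \<open>8 t\<close> neighbours one lies off two given lines. The bipartite constant is the
  sum of \<open>16 t\<close> (up to \<open>8 t\<close> ones at each of the two ends of every row and
  column) and \<open>3 t^2\<close> (three bad crossings per segment, each accounting for at most
  \<open>t^2\<close> incomplete blocks). The further factor 3 comes from
  \<open>ln (2/3) <= -1/3\<close> in the halving step.\<close>

lemma Jordan_facts:
  fixes K :: "real \<Rightarrow> complex"
  assumes "simple_path K" "pathfinish K = pathstart K"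
  shows "open (outside (path_image K))" "connected (outside (path_image K))"
    "\<not> bounded (outside (path_image K))" "outside (path_image K) \<noteq> {}"
    "frontier (outside (path_image K)) = path_image K"
    "open (inside (path_image K))" "connected (inside (path_image K))"
    "frontier (inside (path_image K)) = path_image K"
    "inside (path_image K) \<noteq> {}"
  using Jordan_inside_outside[OF assms] by auto

lemma unbounded_connected_subset_outside:
  assumes "connected X" "\<not> bounded X" "X \<inter> J = {}"
  shows "X \<subseteq> outside J"
proof
  fix x assume "x \<in> X"
  then have "X \<subseteq> connected_component_set (- J) x"
    using assms by (intro connected_component_maximal) auto
  then show "x \<in> outside J"
    using assms(2) bounded_subset by (auto simp: outside)
qed

lemma connected_disjoint_subset_inside:
  assumes "connected X" "X \<inter> J = {}" "X \<inter> inside J \<noteq> {}"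
  shows "X \<subseteq> inside J"
proof -
  obtain x where x: "x \<in> X" "x \<in> inside J" using assms by auto
  then have "X \<subseteq> connected_component_set (- J) x"
    using assms by (intro connected_component_maximal) auto
  then show ?thesis
    using x inside_same_component by blast
qed

text \<open>\<open>K\<close> is cut into two closed pieces that meet only inside the obstacle \<open>P\<close>; by Janiszewski's
  theorem \<open>P\<close> then separates the pieces from each other within the closed region bounded by \<open>K\<close>.\<close>

lemma chord_separates:
  fixes K :: "real \<Rightarrow> complex"
  assumes K: "simple_path K" "pathfinish K = pathstart K"
    and Ki: "closed K1" "closed K2" "K1 \<union> K2 = path_image K" "K1 \<inter> K2 \<subseteq> P"
    and P: "compact P" "connected P" "connected (- P)" "P \<inter> outside (path_image K) = {}"
    and X: "connected X" "X \<inter> P = {}" "X \<inter> outside (path_image K) = {}" "X \<inter> K1 \<noteq> {}"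
    and Y: "connected Y" "Y \<inter> P = {}" "Y \<inter> outside (path_image K) = {}" "Y \<inter> K2 \<noteq> {}"
    and xy: "x \<in> X" "y \<in> Y"
      "connected_component (- (K1 \<union> P)) x y \<or> connected_component (- (K2 \<union> P)) x y"
  shows False
proof -
  define ou where "ou = outside (path_image K)"
  note J = Jordan_facts[OF K, folded ou_def]
  obtain o0 where o0: "o0 \<in> ou" using J(4) by auto
  have ouK: "ou \<inter> path_image K = {}" by (simp add: ou_def)
  \<comment> \<open>\<open>A1\<close> and \<open>A2\<close> collect what can be reached from the
    outside while avoiding \<open>P\<close> and one piece of \<open>K\<close>. They turn out to be
    disjoint and to cover the closed region off \<open>P\<close>, with \<open>X\<close> in
    \<open>A2\<close> and \<open>Y\<close> in \<open>A1\<close>.\<close>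
  define A1 where "A1 = connected_component_set (- (K1 \<union> P)) o0"
  define A2 where "A2 = connected_component_set (- (K2 \<union> P)) o0"
  have cl: "closed P" using P(1) compact_imp_closed by blast
  have oA: "open A1" "open A2"
    unfolding A1_def A2_def using Ki cl by (auto intro!: open_connected_component)
  have ouA: "ou \<subseteq> A1" "ou \<subseteq> A2"
    unfolding A1_def A2_def using J(2) o0 ouK P(4) Ki(3)
    by (intro connected_component_maximal; fastforce simp: ou_def)+
  have cK: "compact (K1 \<union> P)" "compact (K2 \<union> P)"
    using Ki K P(1)
    by (metis Un_upper1 Un_upper2 compact_Int_closed compact_Un compact_simple_path_image inf.absorb_iff2)+
  \<comment> \<open>The two obstacles share exactly the connected set \<open>P\<close>, so by
    Janiszewski's theorem a point reachable past each of them is reachable past both, that is,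
    without touching \<open>K\<close> at all.\<close>
  have disj: "z \<notin> A1 \<or> z \<notin> A2" if z: "z \<notin> ou" "z \<notin> P" for z
  proof (rule ccontr)
    assume "\<not> ?thesis"
    then have cz: "connected_component (- (K1 \<union> P)) o0 z" "connected_component (- (K2 \<union> P)) o0 z"
      by (auto simp: A1_def A2_def)
    have "(K1 \<union> P) \<inter> (K2 \<union> P) = P" using Ki by auto
    then have "connected_component (- ((K1 \<union> P) \<union> (K2 \<union> P))) o0 z"
      using Janiszewski[OF cK(1) compact_imp_closed[OF cK(2)] _ cz] P(2) by simp
    then have "connected_component (- path_image K) o0 z"
      by (rule connected_component_of_subset) (use Ki in auto)
    then have "z \<in> ou"
      using o0 unfolding ou_def by (metis outside_same_component)
    with z show False by auto
  qed
  \<comment> \<open>Points of \<open>K\<close> are limits of outside points, so a point of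
    \<open>K1\<close> off \<open>P\<close> is reached from the outside within a ball that misses
    \<open>K2\<close> and \<open>P\<close>.\<close>
  have K1A: "z \<in> A2" if "z \<in> K1" "z \<notin> P" for z
  proof -
    have zn: "z \<in> - (K2 \<union> P)" using that Ki by auto
    moreover have "open (- (K2 \<union> P))" using Ki cl by auto
    ultimately obtain e where e: "e > 0" "ball z e \<subseteq> - (K2 \<union> P)"
      by (meson open_contains_ball)
    have "z \<in> closure ou" using J(5) that Ki by (auto simp: frontier_def)
    then obtain w where w: "w \<in> ou" "dist w z < e" using e closure_approachable by blast
    have "connected_component (- (K2 \<union> P)) w z"
      unfolding connected_component_def using e w by (intro exI[of _ "ball z e"]) (auto simp: dist_commute)
    then show ?thesis using ouA w by (auto simp: A2_def intro: connected_component_trans)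
  qed
  have K2A: "z \<in> A1" if "z \<in> K2" "z \<notin> P" for z
  proof -
    have zn: "z \<in> - (K1 \<union> P)" using that Ki by auto
    moreover have "open (- (K1 \<union> P))" using Ki cl by auto
    ultimately obtain e where e: "e > 0" "ball z e \<subseteq> - (K1 \<union> P)"
      by (meson open_contains_ball)
    have "z \<in> closure ou" using J(5) that Ki by (auto simp: frontier_def)
    then obtain w where w: "w \<in> ou" "dist w z < e" using e closure_approachable by blast
    have "connected_component (- (K1 \<union> P)) w z"
      unfolding connected_component_def using e w by (intro exI[of _ "ball z e"]) (auto simp: dist_commute)
    then show ?thesis using ouA w by (auto simp: A1_def intro: connected_component_trans)
  qed
  have cover: "z \<in> A1 \<or> z \<in> A2" if z: "z \<notin> ou" "z \<notin> P" for z
  proof (cases "z \<in> path_image K")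
    case True
    then show ?thesis using Ki K1A K2A z by auto
  next
    case False
    let ?W = "- (path_image K \<union> P)"
    define U where "U = connected_component_set ?W z"
    have zU: "z \<in> U" using False z by (simp add: U_def)
    have opU: "open U" unfolding U_def
      using cl K by (intro open_connected_component open_Compl closed_Un closed_simple_path_image)
    have UW: "U \<subseteq> ?W" by (auto simp: U_def dest: connected_component_in)
    have conU: "connected U" by (simp add: U_def)
    have "\<exists>w. w \<in> closure U \<and> w \<in> path_image K \<and> w \<notin> P"
    proof (rule ccontr)
      assume no: "\<not> ?thesis"
      \<comment> \<open>If the component \<open>U\<close> touched \<open>K\<close> only within
        \<open>P\<close>, it would be closed as well as open in the connected set
        \<open>- P\<close>, hence equal to it, and would contain outside points.\<close>
      have "closure U \<inter> - P \<subseteq> U"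
      proof
        fix w assume w: "w \<in> closure U \<inter> - P"
        then have "insert w U \<subseteq> ?W" using no UW by auto
        moreover have "connected (insert w U)"
          using conU w by (metis IntD1 closure_subset connected_intermediate_closure insert_subset subset_insertI)
        ultimately have "insert w U \<subseteq> connected_component_set ?W z"
          using zU by (intro connected_component_maximal) auto
        then show "w \<in> U" by (auto simp: U_def)
      qed
      then have "closure U \<inter> - P = U" using UW closure_subset by auto
      then have "closedin (top_of_set (- P)) U"
        by (metis closed_closure closedin_closed_Int inf_commute)
      moreover have "openin (top_of_set (- P)) U"
        using opU UW by (metis Compl_subset_Compl_iff open_subset order_trans sup_ge2)
      ultimately have "U = - P"
        using P(3) zU unfolding connected_clopen by blast
      then have "o0 \<in> U" using o0 P(4) by (auto simp: ou_def)
      then have "connected_component (- path_image K) z o0"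
        by (auto simp: U_def intro: connected_component_of_subset)
      then have "z \<in> ou"
        using o0 unfolding ou_def by (metis connected_component_sym outside_same_component)
      with z show False by auto
    qed
    then obtain w where w: "w \<in> closure U" "w \<in> path_image K" "w \<notin> P" by auto
    show ?thesis
    proof (cases "w \<in> K1")
      case True
      then have "w \<in> A2" using K1A w by auto
      then obtain w' where w': "w' \<in> A2" "w' \<in> U"
        using w oA by (metis closure_iff_nhds_not_empty disjoint_iff subset_refl)
      then have "U \<subseteq> connected_component_set (- (K2 \<union> P)) w'"
        using conU UW Ki by (intro connected_component_maximal) auto
      then have "z \<in> A2" using w' zU unfolding A2_def
        by (metis connected_component_eq subsetD)
      then show ?thesis ..
    next
      case False
      then have "w \<in> A1" using K2A w Ki by auto
      then obtain w' where w': "w' \<in> A1" "w' \<in> U"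
        using w oA by (metis closure_iff_nhds_not_empty disjoint_iff subset_refl)
      then have "U \<subseteq> connected_component_set (- (K1 \<union> P)) w'"
        using conU UW Ki by (intro connected_component_maximal) auto
      then have "z \<in> A1" using w' zU unfolding A1_def
        by (metis connected_component_eq subsetD)
      then show ?thesis ..
    qed
  qed
  have notself: "z \<notin> A1" if "z \<in> K1" for z
    using that by (auto simp: A1_def dest: connected_component_in)
  have notself2: "z \<notin> A2" if "z \<in> K2" for z
    using that by (auto simp: A2_def dest: connected_component_in)
  have XA: "X \<subseteq> A2"
  proof -
    have "X \<subseteq> A1 \<union> A2" "A1 \<inter> A2 \<inter> X = {}" using X cover disj by (auto simp: ou_def)
    moreover obtain k where "k \<in> X" "k \<in> A2" using X K1A by blast
    ultimately have "A1 \<inter> X = {}"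
      using connectedD[OF X(1) oA] by (auto simp: Int_ac)
    then show ?thesis using \<open>X \<subseteq> A1 \<union> A2\<close> by auto
  qed
  have YA: "Y \<subseteq> A1"
  proof -
    have "Y \<subseteq> A1 \<union> A2" "A1 \<inter> A2 \<inter> Y = {}" using Y cover disj by (auto simp: ou_def)
    moreover obtain k where "k \<in> Y" "k \<in> A1" using Y K2A by blast
    ultimately have "A2 \<inter> Y = {}"
      using connectedD[OF Y(1) oA] by (auto simp: Int_ac)
    then show ?thesis using \<open>Y \<subseteq> A1 \<union> A2\<close> by auto
  qed
  from xy(3) show False
  proof
    assume "connected_component (- (K1 \<union> P)) x y"
    then have "x \<in> A1" using YA xy unfolding A1_def
      by (metis connected_component_sym connected_component_trans mem_Collect_eq subsetD)
    then show False using disj[of x] XA xy X by (auto simp: ou_def)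
  next
    assume "connected_component (- (K2 \<union> P)) x y"
    then have "y \<in> A2" using XA xy unfolding A2_def
      by (metis connected_component_trans mem_Collect_eq subsetD)
    then show False using disj[of y] YA xy Y by (auto simp: ou_def)
  qed
qed

text \<open>Janiszewski's theorem is applied to the closed curve and to its part away from \<open>r\<close> together
  with the complement of the ball.\<close>

lemma locally_connected_off_curve:
  fixes g :: "real \<Rightarrow> complex"
  assumes g: "arc g" and S: "compact S" "connected S" "pathstart g \<in> S" "pathfinish g \<in> S"
    and r: "r \<in> path_image g" "r \<notin> S" and e: "e > 0"
  shows "\<exists>d>0. \<forall>x\<in>ball r d. \<forall>y\<in>ball r d.
     connected_component (- (path_image g \<union> S)) x y \<longrightarrow>
     connected_component (ball r e - (path_image g \<union> S)) x y"
proof -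
  obtain \<tau> where \<tau>: "\<tau> \<in> {0..1}" "r = g \<tau>" using r by (auto simp: path_image_def)
  have cont: "continuous_on {0..1} g" using g by (simp add: arc_def path_def)
  have inj: "inj_on g {0..1}" using g by (simp add: arc_def)
  obtain \<epsilon> where \<epsilon>: "\<epsilon> > 0" "\<And>s. s \<in> {0..1} \<Longrightarrow> dist s \<tau> < \<epsilon> \<Longrightarrow> dist (g s) (g \<tau>) < e"
    using cont \<tau> e unfolding continuous_on_iff by metis
  have ends: "\<tau> \<noteq> 0" "\<tau> \<noteq> 1" using S r \<tau> by (auto simp: pathstart_def pathfinish_def)
  define \<delta> where "\<delta> = Min {\<epsilon>, \<tau>, 1 - \<tau>} / 2"
  have \<delta>: "\<delta> > 0" "\<delta> < \<epsilon>" "\<delta> < \<tau>" "\<delta> < 1 - \<tau>" using \<epsilon> \<tau> ends by (auto simp: \<delta>_def min_def)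
  \<comment> \<open>The closed curve without a short open stretch around \<open>r\<close> that lies
    in the ball. \<open>S\<close> joins the two remaining pieces of \<open>g\<close>, so
    \<open>J1\<close> is connected; it is the intersection whose connectedness Janiszewski's theorem
    requires.\<close>
  define J1 where "J1 = g ` {0..\<tau> - \<delta>} \<union> S \<union> g ` {\<tau> + \<delta>..1}"
  have sub: "{0..\<tau> - \<delta>} \<subseteq> {0..1}" "{\<tau> + \<delta>..1} \<subseteq> {0..1}" using \<delta> \<tau> by auto
  have c: "connected (g ` {0..\<tau> - \<delta>})" "connected (g ` {\<tau> + \<delta>..1})"
    using cont sub by (auto intro!: connected_continuous_image intro: continuous_on_subset)
  have co: "compact (g ` {0..\<tau> - \<delta>})" "compact (g ` {\<tau> + \<delta>..1})"
    using cont sub by (auto intro!: compact_continuous_image intro: continuous_on_subset)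
  have J1c: "connected J1" unfolding J1_def
  proof (intro connected_Un c S)
    have "g 0 \<in> g ` {0..\<tau> - \<delta>} \<inter> S" using S \<delta> by (auto simp: pathstart_def)
    then show "g ` {0..\<tau> - \<delta>} \<inter> S \<noteq> {}" by auto
    have "g 1 \<in> (g ` {0..\<tau> - \<delta>} \<union> S) \<inter> g ` {\<tau> + \<delta>..1}" using S \<delta> by (auto simp: pathfinish_def)
    then show "(g ` {0..\<tau> - \<delta>} \<union> S) \<inter> g ` {\<tau> + \<delta>..1} \<noteq> {}" by auto
  qed
  have J1co: "compact J1" unfolding J1_def using co S by (intro compact_Un)
  have rJ: "r \<notin> J1"
  proof
    assume "r \<in> J1"
    then obtain s where s: "s \<in> {0..\<tau> - \<delta>} \<union> {\<tau> + \<delta>..1}" "g s = g \<tau>" using r \<tau> unfolding J1_def by blast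
    then have "s = \<tau>" using inj \<tau> sub by (meson UnE inj_onD subsetD)
    then show False using s \<delta> by auto
  qed
  let ?J = "path_image g \<union> S"
  have JJ: "J1 \<subseteq> ?J" using sub by (auto simp: J1_def path_image_def)
  have far: "?J - ball r e \<subseteq> J1"
  proof
    fix z assume z: "z \<in> ?J - ball r e"
    show "z \<in> J1"
    proof (cases "z \<in> S")
      case False
      then obtain s where s: "s \<in> {0..1}" "z = g s" using z by (auto simp: path_image_def)
      then have "\<not> dist s \<tau> < \<epsilon>" using \<epsilon>(2)[of s] z \<tau> by (auto simp: dist_commute)
      then have "s \<in> {0..\<tau> - \<delta>} \<or> s \<in> {\<tau> + \<delta>..1}" using \<delta> s by (auto simp: dist_real_def abs_if split: if_splits)
      then show ?thesis using s by (auto simp: J1_def)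
    qed (auto simp: J1_def)
  qed
  obtain d0 where d0: "d0 > 0" "ball r d0 \<subseteq> - J1"
    using rJ compact_imp_closed[OF J1co] by (meson ComplI open_Compl open_contains_ball)
  define d where "d = min d0 e"
  have d: "d > 0" "ball r d \<subseteq> - J1" "ball r d \<subseteq> ball r e" using d0 e by (auto simp: d_def)
  show ?thesis
  proof (intro exI conjI ballI impI)
    show "d > 0" by (rule d)
    fix x y assume xy: "x \<in> ball r d" "y \<in> ball r d" "connected_component (- ?J) x y"
    have "connected_component (- (?J \<union> (J1 \<union> - ball r e))) x y"
    proof (rule Janiszewski)
      show "compact ?J" using g S by (auto simp: compact_arc_image)
      show "closed (J1 \<union> - ball r e)" using J1co compact_imp_closed by auto
      have "?J \<inter> (J1 \<union> - ball r e) = J1" using JJ far by auto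
      then show "connected (?J \<inter> (J1 \<union> - ball r e))" using J1c by simp
      show "connected_component (- ?J) x y" by fact
      show "connected_component (- (J1 \<union> - ball r e)) x y"
        unfolding connected_component_def using d xy by (intro exI[of _ "ball r d"]) auto
    qed
    then show "connected_component (ball r e - ?J) x y"
      by (rule connected_component_of_subset) auto
  qed
qed

section \<open>Theta curves: three arcs with common ends\<close>

lemma Jordan_curve_of_two_arcs:
  assumes "arc c1" "arc c2" "pathstart c1 = a" "pathfinish c1 = b" "pathstart c2 = a" "pathfinish c2 = b"
    "path_image c1 \<inter> path_image c2 = {a, b}"
  shows "\<exists>K. simple_path K \<and> pathfinish K = pathstart K \<and> path_image K = path_image c1 \<union> path_image c2"
proof (intro exI conjI)
  show "simple_path (c1 +++ reversepath c2)"
    using assms by (intro simple_path_join_loop) (auto simp: arc_reversepath)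
  show "pathfinish (c1 +++ reversepath c2) = pathstart (c1 +++ reversepath c2)" using assms by simp
  show "path_image (c1 +++ reversepath c2) = path_image c1 \<union> path_image c2"
    using assms by (simp add: path_image_join)
qed

lemma arc_has_inner_point:
  assumes "arc c" shows "\<exists>z \<in> path_image c. z \<noteq> pathstart c \<and> z \<noteq> pathfinish c"
proof -
  have "c (1/2) \<noteq> c 0" "c (1/2) \<noteq> c 1"
    using assms by (auto simp: arc_def dest!: inj_onD)
  then show ?thesis by (force simp: path_image_def pathstart_def pathfinish_def)
qed

text \<open>Near \<open>m\<close> one side of \<open>c3\<close> belongs to the outside
  \<open>W\<close>, so the insides of the two Jordan curves through \<open>c3\<close> must share the
  other side. If neither \<open>c1\<close> nor \<open>c2\<close> entered the inside belonging to the
  other, these two insides would coincide, and comparing frontiers would give \<open>c1\<close> and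
  \<open>c2\<close> the same inner points.\<close>

lemma theta_touched_arc:
  fixes c1 c2 c3 :: "real \<Rightarrow> complex"
  assumes arcs: "arc c1" "arc c2" "arc c3"
    and s: "pathstart c1 = a" "pathstart c2 = a" "pathstart c3 = a"
    and f: "pathfinish c1 = b" "pathfinish c2 = b" "pathfinish c3 = b"
    and I: "path_image c1 \<inter> path_image c2 = {a, b}" "path_image c1 \<inter> path_image c3 = {a, b}"
      "path_image c2 \<inter> path_image c3 = {a, b}"
    and m: "m \<in> path_image c3" "m \<noteq> a" "m \<noteq> b"
      "m \<in> closure (outside (path_image c1 \<union> path_image c2 \<union> path_image c3))"
  shows "path_image c1 \<inter> inside (path_image c2 \<union> path_image c3) \<noteq> {} \<or>
    path_image c2 \<inter> inside (path_image c1 \<union> path_image c3) \<noteq> {}"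
proof (rule ccontr)
  assume neg: "\<not> ?thesis"
  define T1 where "T1 = inside (path_image c1 \<union> path_image c3)"
  define T2 where "T2 = inside (path_image c2 \<union> path_image c3)"
  define W where "W = outside (path_image c1 \<union> path_image c2 \<union> path_image c3)"
  obtain k1 where k1: "simple_path k1" "pathfinish k1 = pathstart k1" "path_image k1 = path_image c1 \<union> path_image c3"
    using Jordan_curve_of_two_arcs arcs s f I by metis
  obtain k2 where k2: "simple_path k2" "pathfinish k2 = pathstart k2" "path_image k2 = path_image c2 \<union> path_image c3"
    using Jordan_curve_of_two_arcs arcs s f I by metis
  note J1 = Jordan_facts[OF k1(1,2), unfolded k1(3)] and J2 = Jordan_facts[OF k2(1,2), unfolded k2(3)]
  have mn: "m \<notin> path_image c1 \<union> path_image c2" using m I by auto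
  have "closed (path_image c1 \<union> path_image c2)" using arcs by (auto simp: closed_arc_image)
  then obtain e where e: "e > 0" "ball m e \<subseteq> - (path_image c1 \<union> path_image c2)"
    using mn by (meson ComplI open_Compl open_contains_ball)
  have se: "a \<in> path_image c1" "b \<in> path_image c1" using I by auto
  have c: "compact (path_image c1)" "connected (path_image c1)"
    using arcs by (auto simp: compact_arc_image connected_arc_image)
  obtain d1 where d1: "d1 > 0" "\<forall>x\<in>ball m d1. \<forall>y\<in>ball m d1.
     connected_component (- (path_image c3 \<union> path_image c1)) x y \<longrightarrow>
     connected_component (ball m e - (path_image c3 \<union> path_image c1)) x y"
    using locally_connected_off_curve[OF arcs(3) c(1,2) _ _ m(1) _ e(1)] se s f mn by auto
  define d where "d = min d1 e"
  have d: "d > 0" "d \<le> d1" "d \<le> e" using d1 e by (auto simp: d_def)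
  obtain w where w: "w \<in> W" "w \<in> ball m d"
    using m(4) d(1) unfolding W_def closure_approachable by (auto simp: dist_commute)
  have "m \<in> closure T2" using J2(8) m by (auto simp: frontier_def T2_def)
  then obtain y where y: "y \<in> T2" "y \<in> ball m d"
    using d(1) unfolding closure_approachable by (auto simp: dist_commute)
  \<comment> \<open>Otherwise \<open>w\<close> and \<open>y\<close> both lie outside
    \<open>c1 \<union> c3\<close>. Near \<open>m\<close> they are then joined within a ball that
    also misses \<open>c2\<close>, which puts \<open>y\<close> into \<open>W\<close>.\<close>
  have yT1: "y \<in> T1"
  proof (rule ccontr)
    assume "y \<notin> T1"
    moreover have "y \<notin> path_image c3"
      using y inside_no_overlap[of "path_image c2 \<union> path_image c3"] unfolding T2_def by blast
    moreover have "y \<notin> path_image c1"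
      using y subsetD[OF e(2), of y] d by auto
    ultimately have yo: "y \<in> outside (path_image c1 \<union> path_image c3)"
      using inside_Un_outside unfolding T1_def by blast
    have "w \<in> outside (path_image c1 \<union> path_image c3)"
      using w outside_mono[of "path_image c1 \<union> path_image c3" "path_image c1 \<union> path_image c2 \<union> path_image c3"]
      unfolding W_def by auto
    then have "connected_component (- (path_image c3 \<union> path_image c1)) w y"
      unfolding connected_component_def using yo J1(2) outside_no_overlap[of "path_image c1 \<union> path_image c3"]
      by (intro exI[of _ "outside (path_image c1 \<union> path_image c3)"]) blast
    then have "connected_component (ball m e - (path_image c3 \<union> path_image c1)) w y"
      using d1 w y d by auto
    then have "connected_component (- (path_image c1 \<union> path_image c2 \<union> path_image c3)) w y"
      by (rule connected_component_of_subset) (use e in auto)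
    then have "y \<in> W" using w unfolding W_def by (metis outside_same_component)
    then have "y \<in> outside (path_image c2 \<union> path_image c3)"
      using outside_mono[of "path_image c2 \<union> path_image c3" "path_image c1 \<union> path_image c2 \<union> path_image c3"]
      unfolding W_def by auto
    then show False using y inside_Int_outside unfolding T2_def by blast
  qed
  have "T2 \<subseteq> T1" unfolding T1_def
  proof (rule connected_disjoint_subset_inside)
    show "connected T2" using J2 by (simp add: T2_def)
    show "T2 \<inter> (path_image c1 \<union> path_image c3) = {}"
      using neg inside_no_overlap[of "path_image c2 \<union> path_image c3"] unfolding T2_def by blast
    show "T2 \<inter> inside (path_image c1 \<union> path_image c3) \<noteq> {}" using y yT1 by (auto simp: T1_def)
  qed
  moreover have "T1 \<subseteq> T2" unfolding T2_def
  proof (rule connected_disjoint_subset_inside)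
    show "connected T1" using J1 by (simp add: T1_def)
    show "T1 \<inter> (path_image c2 \<union> path_image c3) = {}"
      using neg inside_no_overlap[of "path_image c1 \<union> path_image c3"] unfolding T1_def by blast
    show "T1 \<inter> inside (path_image c2 \<union> path_image c3) \<noteq> {}" using y yT1 by (auto simp: T2_def)
  qed
  ultimately have "T1 = T2" by auto
  then have "frontier T1 = frontier T2" by (rule arg_cong)
  then have eq: "path_image c1 \<union> path_image c3 = path_image c2 \<union> path_image c3"
    unfolding T1_def T2_def J1(8) J2(8) .
  obtain z where "z \<in> path_image c1" "z \<noteq> a" "z \<noteq> b" using arc_has_inner_point[OF arcs(1)] s f by auto
  then show False using eq I by auto
qed

text \<open>Two points do not separate the plane, so the outside of the theta curve touches it at
  some point other than \<open>a\<close> and \<open>b\<close>. The arc containing this point plays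
  \<open>c3\<close> in \<open>theta_touched_arc\<close>.\<close>

lemma theta_inside:
  fixes c1 c2 c3 :: "real \<Rightarrow> complex"
  assumes arcs: "arc c1" "arc c2" "arc c3"
    and s: "pathstart c1 = a" "pathstart c2 = a" "pathstart c3 = a"
    and f: "pathfinish c1 = b" "pathfinish c2 = b" "pathfinish c3 = b"
    and I: "path_image c1 \<inter> path_image c2 = {a, b}" "path_image c1 \<inter> path_image c3 = {a, b}"
      "path_image c2 \<inter> path_image c3 = {a, b}"
  shows "path_image c1 \<inter> inside (path_image c2 \<union> path_image c3) \<noteq> {} \<or>
    path_image c2 \<inter> inside (path_image c1 \<union> path_image c3) \<noteq> {} \<or>
    path_image c3 \<inter> inside (path_image c1 \<union> path_image c2) \<noteq> {}"
proof -
  define \<Theta> where "\<Theta> = path_image c1 \<union> path_image c2 \<union> path_image c3"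
  define W where "W = outside \<Theta>"
  have co: "compact \<Theta>" unfolding \<Theta>_def using arcs by (intro compact_Un compact_arc_image)
  have W: "open W" "W \<noteq> {}"
    using co by (auto simp: W_def open_outside compact_imp_closed outside_bounded_nonempty compact_imp_bounded)
  obtain z where z: "z \<in> path_image c1" "z \<noteq> a" "z \<noteq> b" using arc_has_inner_point[OF arcs(1)] s f by auto
  have "\<exists>m. m \<in> closure W \<and> m \<in> \<Theta> \<and> m \<noteq> a \<and> m \<noteq> b"
  proof (rule ccontr)
    assume no: "\<not> ?thesis"
    have WT: "W \<inter> \<Theta> = {}" by (simp add: W_def)
    have ab: "a \<in> \<Theta>" "b \<in> \<Theta>" using I by (auto simp: \<Theta>_def)
    have "closure W \<inter> - {a, b} \<subseteq> W"
    proof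
      fix x assume x: "x \<in> closure W \<inter> - {a, b}"
      then have xn: "x \<notin> \<Theta>" using no by auto
      moreover have "frontier W \<subseteq> \<Theta>" unfolding W_def
        using co compact_imp_closed frontier_outside_subset by blast
      ultimately show "x \<in> W" using x W by (auto simp: frontier_def interior_open)
    qed
    then have "closure W \<inter> - {a, b} = W" using WT ab closure_subset by auto
    then have "closedin (top_of_set (- {a, b})) W"
      by (metis closed_closure closedin_closed_Int inf_commute)
    moreover have "openin (top_of_set (- {a, b})) W"
      using W WT ab by (intro open_subset) auto
    moreover have "connected (- {a, b})"
      unfolding Compl_eq_Diff_UNIV by (intro connected_open_delete_finite) auto
    ultimately have "W = - {a, b}" using W(2) connected_clopen by blast
    then have "z \<in> W" using z by auto
    then show False using WT z by (auto simp: \<Theta>_def)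
  qed
  then obtain m where m: "m \<in> closure W" "m \<in> \<Theta>" "m \<noteq> a" "m \<noteq> b" by auto
  from m(2) consider "m \<in> path_image c1" | "m \<in> path_image c2" | "m \<in> path_image c3"
    by (auto simp: \<Theta>_def)
  then show ?thesis
  proof cases
    case 1
    have "path_image c2 \<inter> inside (path_image c3 \<union> path_image c1) \<noteq> {} \<or>
      path_image c3 \<inter> inside (path_image c2 \<union> path_image c1) \<noteq> {}"
      using m 1 I by (intro theta_touched_arc[OF arcs(2,3,1) s(2,3,1) f(2,3,1)])
        (auto simp: W_def \<Theta>_def Un_ac Int_ac)
    then show ?thesis by (auto simp: Un_ac)
  next
    case 2
    have "path_image c1 \<inter> inside (path_image c3 \<union> path_image c2) \<noteq> {} \<or>
      path_image c3 \<inter> inside (path_image c1 \<union> path_image c2) \<noteq> {}"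
      using m 2 I by (intro theta_touched_arc[OF arcs(1,3,2) s(1,3,2) f(1,3,2)])
        (auto simp: W_def \<Theta>_def Un_ac Int_ac)
    then show ?thesis by (auto simp: Un_ac)
  next
    case 3
    have "path_image c1 \<inter> inside (path_image c2 \<union> path_image c3) \<noteq> {} \<or>
      path_image c2 \<inter> inside (path_image c1 \<union> path_image c3) \<noteq> {}"
      using m 3 I by (intro theta_touched_arc[OF arcs s f]) (auto simp: W_def \<Theta>_def Un_ac Int_ac)
    then show ?thesis by (auto simp: Un_ac)
  qed
qed

section \<open>Arcs of pseudolines\<close>

lemma pseudoline_parametrization:
  assumes "pseudoline L" "u \<in> L" "v \<in> L" "u \<noteq> v"
  obtains g h where "homeomorphism (UNIV :: real set) L g h" "h u < h v"
proof -
  obtain h g where hg: "homeomorphism L (UNIV :: real set) h g"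
    using assms by (auto simp: pseudoline_def homeomorphic_def)
  then have gh: "homeomorphism (UNIV :: real set) L g h" by (rule homeomorphism_symD)
  have "g (h u) = u" "g (h v) = v" using gh assms unfolding homeomorphism_def by blast+
  then have "h u \<noteq> h v" using assms by auto
  then consider "h u < h v" | "h v < h u" by linarith
  then show ?thesis
  proof cases
    case 1 with gh that show ?thesis by blast
  next
    case 2
    have "homeomorphism (UNIV :: real set) UNIV uminus uminus"
      by (auto simp: homeomorphism_def intro!: continuous_intros)
    from homeomorphism_compose[OF this gh]
    have "homeomorphism UNIV L (g \<circ> uminus) (uminus \<circ> h)" .
    then show ?thesis using that 2 by fastforce
  qed
qed

lemma line_homeomorphismD:
  assumes "homeomorphism (UNIV :: real set) L g h"
  shows "inj g" "continuous_on UNIV g" "continuous_on L h" "h (g x) = x" "g x \<in> L" "z \<in> L \<Longrightarrow> g (h z) = z"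
proof -
  show *: "h (g x) = x" for x using assms by (auto simp: homeomorphism_def)
  show "inj g" by (rule inj_on_inverseI[of _ h]) (simp add: *)
  show "continuous_on UNIV g" "continuous_on L h" "g x \<in> L" "z \<in> L \<Longrightarrow> g (h z) = z"
    using assms unfolding homeomorphism_def by blast+
qed

text \<open>The choice in \<open>pl_arc\<close> is harmless: two parametrizations of
  \<open>L\<close> differ by a continuous injective map of the reals, and such a map sends segments
  onto segments.\<close>

lemma pl_arc_eq:
  assumes gh: "homeomorphism (UNIV :: real set) L g h" and uv: "u \<in> L" "v \<in> L"
  shows "pl_arc L u v = g ` closed_segment (h u) (h v)"
proof -
  let ?P = "\<lambda>S. \<exists>g h a b. homeomorphism (UNIV :: real set) L g h \<and>
        g a = u \<and> g b = v \<and> S = g ` closed_segment a b"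
  have "?P (g ` closed_segment (h u) (h v))"
    using gh line_homeomorphismD(6)[OF gh] uv by blast
  then have "?P (pl_arc L u v)" unfolding pl_arc_def by (rule someI)
  then obtain g' h' a b where g': "homeomorphism (UNIV :: real set) L g' h'" "g' a = u" "g' b = v"
    "pl_arc L u v = g' ` closed_segment a b" by blast
  have "(h \<circ> g') ` closed_segment a b = closed_segment ((h \<circ> g') a) ((h \<circ> g') b)"
  proof (rule continuous_injective_image_segment_1)
    have "continuous_on UNIV (h \<circ> g')"
      using line_homeomorphismD(2,5)[OF g'(1)] line_homeomorphismD(3)[OF gh]
      by (intro continuous_on_compose) (auto intro: continuous_on_subset)
    then show "continuous_on (closed_segment a b) (h \<circ> g')" using continuous_on_subset by blast
    show "inj_on (h \<circ> g') (closed_segment a b)"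
    proof (rule inj_onI)
      fix x y assume "(h \<circ> g') x = (h \<circ> g') y"
      then have "g (h (g' x)) = g (h (g' y))" by simp
      then have "g' x = g' y" using line_homeomorphismD(6)[OF gh] line_homeomorphismD(5)[OF g'(1)] by simp
      then show "x = y" using line_homeomorphismD(1)[OF g'(1)] by (simp add: inj_def)
    qed
  qed
  then have "g ` (h ` g' ` closed_segment a b) = g ` closed_segment (h u) (h v)"
    using g' by (simp add: image_comp)
  moreover have "g ` (h ` g' ` closed_segment a b) = g' ` closed_segment a b"
    unfolding image_image using line_homeomorphismD(6)[OF gh] line_homeomorphismD(5)[OF g'(1)]
    by (intro image_cong) auto
  ultimately show ?thesis using g' by simp
qed

lemma pl_arc_commute:
  assumes "pseudoline L" "u \<in> L" "v \<in> L"
  shows "pl_arc L u v = pl_arc L v u"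
proof (cases "u = v")
  case False
  then obtain g h where "homeomorphism (UNIV :: real set) L g h"
    using pseudoline_parametrization assms by blast
  then show ?thesis using pl_arc_eq assms by (simp add: closed_segment_commute)
qed simp

lemma pl_arc_is_arc:
  assumes L: "pseudoline L" "u \<in> L" "v \<in> L" "u \<noteq> v"
  obtains c where "arc c" "pathstart c = u" "pathfinish c = v" "path_image c = pl_arc L u v"
proof -
  obtain g h where gh: "homeomorphism (UNIV :: real set) L g h" "h u < h v"
    using pseudoline_parametrization L by blast
  note D = line_homeomorphismD[OF gh(1)]
  have l: "arc (linepath (h u) (h v))" using gh(2) by simp
  have "inj_on (g \<circ> linepath (h u) (h v)) {0..1}"
    using l D(1) by (intro comp_inj_on) (auto simp: arc_def intro: inj_on_subset)
  then have "arc (g \<circ> linepath (h u) (h v))"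
    using l D(2) by (auto simp: arc_def intro!: path_continuous_image intro: continuous_on_subset)
  moreover have "pathstart (g \<circ> linepath (h u) (h v)) = u" "pathfinish (g \<circ> linepath (h u) (h v)) = v"
    using D(6) L by (auto simp: pathstart_compose pathfinish_compose)
  moreover have "path_image (g \<circ> linepath (h u) (h v)) = pl_arc L u v"
    using pl_arc_eq[OF gh(1) L(2,3)] by (simp add: path_image_compose)
  ultimately show ?thesis using that by blast
qed

lemma pl_arc_subset:
  assumes "pseudoline L" "u \<in> L" "v \<in> L" "u \<noteq> v"
  shows "pl_arc L u v \<subseteq> L" "u \<in> pl_arc L u v" "v \<in> pl_arc L u v"
proof -
  obtain g h where gh: "homeomorphism (UNIV :: real set) L g h"
    using pseudoline_parametrization assms by blast
  then show "pl_arc L u v \<subseteq> L" "u \<in> pl_arc L u v" "v \<in> pl_arc L u v"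
    unfolding pl_arc_eq[OF gh assms(2,3)] using line_homeomorphismD(5)[OF gh]
      imageI[of "h u" "closed_segment (h u) (h v)" g] imageI[of "h v" "closed_segment (h u) (h v)" g]
      line_homeomorphismD(6)[OF gh assms(2)] line_homeomorphismD(6)[OF gh assms(3)]
    by auto
qed

lemma pl_arc_split:
  assumes "pseudoline L" "u \<in> L" "v \<in> L" "u \<noteq> v" "z \<in> pl_arc L u v"
  shows "pl_arc L u z \<union> pl_arc L z v = pl_arc L u v" "pl_arc L u z \<inter> pl_arc L z v = {z}"
proof -
  obtain g h where gh: "homeomorphism (UNIV :: real set) L g h" "h u < h v"
    using pseudoline_parametrization assms by blast
  have zL: "z \<in> L" using assms pl_arc_subset by blast
  note ig = line_homeomorphismD(1)[OF gh(1)] and gz = line_homeomorphismD(6)[OF gh(1) zL]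
  have "g (h z) \<in> g ` closed_segment (h u) (h v)"
    using assms(5) gz unfolding pl_arc_eq[OF gh(1) assms(2,3)] by simp
  then have hz: "h z \<in> {h u..h v}"
    using gh(2) by (simp add: inj_image_mem_iff[OF ig] closed_segment_eq_real_ivl)
  note e = pl_arc_eq[OF gh(1) assms(2,3)] pl_arc_eq[OF gh(1) assms(2) zL] pl_arc_eq[OF gh(1) zL assms(3)]
  have "closed_segment (h u) (h z) \<union> closed_segment (h z) (h v) = closed_segment (h u) (h v)"
    "closed_segment (h u) (h z) \<inter> closed_segment (h z) (h v) = {h z}"
    using hz by (auto simp: closed_segment_eq_real_ivl)
  then show "pl_arc L u z \<union> pl_arc L z v = pl_arc L u v" "pl_arc L u z \<inter> pl_arc L z v = {z}"
    unfolding e image_Un[symmetric] image_Int[OF ig, symmetric] using gz by auto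
qed

text \<open>The ray is the part of \<open>L\<close> after \<open>z\<close> in the direction from
  \<open>u\<close> to \<open>v\<close>. It is unbounded because \<open>L\<close> is closed:
  otherwise its closure would be a compact part of \<open>L\<close>, and \<open>h\<close> would map
  it to a bounded set of parameters.\<close>

lemma pl_arc_ray:
  assumes L: "pseudoline L" "u \<in> L" "v \<in> L" "u \<noteq> v" "z \<in> pl_arc L u v" "z \<noteq> v"
  obtains R where "connected R" "\<not> bounded R" "R \<subseteq> L" "R \<inter> pl_arc L u z = {}"
    "pl_arc L z v - {z} \<subseteq> R" "connected (pl_arc L z v - {z})" "z \<in> closure (pl_arc L z v - {z})"
proof -
  obtain g h where gh: "homeomorphism (UNIV :: real set) L g h" "h u < h v"
    using pseudoline_parametrization L by blast
  have zL: "z \<in> L" using L pl_arc_subset by blast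
  note D = line_homeomorphismD[OF gh(1)]
  note ig = D(1) and cg = D(2) and ch = D(3) and hg = D(4) and gL = D(5)
    and gz = D(6)[OF zL] and gv = D(6)[OF L(3)]
  have "g (h z) \<in> g ` closed_segment (h u) (h v)"
    using L(5) gz unfolding pl_arc_eq[OF gh(1) L(2,3)] by simp
  then have hz: "h z \<in> {h u..h v}"
    using gh(2) by (simp add: inj_image_mem_iff[OF ig] closed_segment_eq_real_ivl)
  have "h z \<noteq> h v" using L(6) gz gv by metis
  with hz have hzv: "h z < h v" by auto
  have e2: "pl_arc L u z = g ` {h u..h z}"
    using pl_arc_eq[OF gh(1) L(2) zL] hz by (simp add: closed_segment_eq_real_ivl)
  have "pl_arc L z v = g ` {h z..h v}"
    using pl_arc_eq[OF gh(1) zL L(3)] hz by (simp add: closed_segment_eq_real_ivl)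
  then have "pl_arc L z v - {z} = g ` ({h z..h v} - {h z})"
    using gz by (simp add: image_set_diff[OF ig])
  moreover have "{h z..h v} - {h z} = {h z<..h v}" by auto
  ultimately have e3: "pl_arc L z v - {z} = g ` {h z<..h v}" by simp
  show ?thesis
  proof (rule that[of "g ` {h z<..}"])
    show "connected (g ` {h z<..})" "connected (pl_arc L z v - {z})" unfolding e3
      using cg by (auto intro!: connected_continuous_image intro: continuous_on_subset)
    show "g ` {h z<..} \<subseteq> L" using gL by auto
    show "g ` {h z<..} \<inter> pl_arc L u z = {}" unfolding e2
      using inj_eq[OF ig] by auto
    show "pl_arc L z v - {z} \<subseteq> g ` {h z<..}" unfolding e3 by auto
    have "g ` closure {h z<..h v} \<subseteq> closure (g ` {h z<..h v})"
      using cg by (intro image_closure_subset) (auto intro: continuous_on_subset closure_subset[THEN subsetD])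
    then show "z \<in> closure (pl_arc L z v - {z})" unfolding e3
      using hzv gz by (auto intro!: image_eqI[of _ g "h z"])
    show "\<not> bounded (g ` {h z<..})"
    proof
      assume b: "bounded (g ` {h z<..})"
      define C where "C = closure (g ` {h z<..})"
      have "closed L" using L by (simp add: pseudoline_def)
      then have CL: "C \<subseteq> L" unfolding C_def using gL by (intro closure_minimal) auto
      have "compact C" unfolding C_def using b by (simp add: compact_closure)
      then have "compact (h ` C)" using CL ch by (intro compact_continuous_image) (auto intro: continuous_on_subset)
      then have "bounded (h ` C)" by (rule compact_imp_bounded)
      moreover have "{h z<..} \<subseteq> h ` C" unfolding C_def using hg closure_subset[of "g ` {h z<..}"]
        by (auto intro!: image_eqI[of _ h "g _"])
      ultimately have "bounded {h z<..}" by (rule bounded_subset)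
      then have "bdd_above {h z<..}" by (rule bounded_imp_bdd_above)
      then obtain M where "\<And>x. h z < x \<Longrightarrow> x \<le> M" by (auto simp: bdd_above_def)
      from this[of "max M (h z) + 1"] show False by linarith
    qed
  qed
qed

section \<open>Chords with interleaved ends\<close>

text \<open>The points \<open>a\<close> and \<open>b\<close> of the Jordan curve \<open>K\<close> separate \<open>c\<close> from \<open>d\<close> on \<open>K\<close>.\<close>

definition interleaved :: "complex set \<Rightarrow> complex \<Rightarrow> complex \<Rightarrow> complex \<Rightarrow> complex \<Rightarrow> bool" where
  "interleaved K a b c d \<longleftrightarrow> (\<exists>K1 K2. closed K1 \<and> closed K2 \<and> K1 \<union> K2 = K \<and> K1 \<inter> K2 = {a, b} \<and>
     c \<in> K1 \<and> d \<in> K2 \<and> c \<notin> {a, b} \<and> d \<notin> {a, b})"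

lemma interleaved_arcs_meet:
  fixes K :: "real \<Rightarrow> complex"
  assumes K: "simple_path K" "pathfinish K = pathstart K"
    and il: "interleaved (path_image K) a b c d"
    and g: "arc g" "pathstart g = a" "pathfinish g = b" "path_image g \<inter> outside (path_image K) = {}"
    and Y: "connected Y" "c \<in> Y" "d \<in> Y" "Y \<inter> outside (path_image K) = {}"
  shows "path_image g \<inter> Y \<noteq> {}"
proof
  assume dis: "path_image g \<inter> Y = {}"
  obtain K1 K2 where k: "closed K1" "closed K2" "K1 \<union> K2 = path_image K" "K1 \<inter> K2 = {a, b}"
    "c \<in> K1" "d \<in> K2" "c \<notin> {a, b}" "d \<notin> {a, b}" using il unfolding interleaved_def by blast
  have ab: "{a, b} \<subseteq> path_image g" using g(2,3) by auto
  have cp: "connected (- path_image g)" using connected_arc_complement[OF g(1)] by simp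
  \<comment> \<open>\<open>Y\<close> serves as both connected sets of
    \<open>chord_separates\<close>, so the connection required between them is that of
    \<open>c\<close> with itself.\<close>
  have "connected_component (- (K2 \<union> path_image g)) c c"
    using k dis Y(2) by (intro connected_component_refl) blast
  then show False
    using k ab dis Y g cp
    by (intro chord_separates[OF K k(1-3) _ compact_arc_image[OF g(1)] connected_arc_image[OF g(1)] cp g(4),
      of Y Y c c]) blast+
qed

lemma bent_arc:
  assumes P: "pseudoline P" "r \<in> P" "v \<in> P" "r \<noteq> v" and Q: "pseudoline Q" "u \<in> Q" "r \<in> Q" "u \<noteq> r"
    and PQ: "P \<inter> Q \<subseteq> {r}"
  obtains c where "arc c" "pathstart c = u" "pathfinish c = v" "path_image c = pl_arc Q u r \<union> pl_arc P r v"
proof -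
  obtain c1 where c1: "arc c1" "pathstart c1 = u" "pathfinish c1 = r" "path_image c1 = pl_arc Q u r"
    using pl_arc_is_arc[OF Q] by blast
  obtain c2 where c2: "arc c2" "pathstart c2 = r" "pathfinish c2 = v" "path_image c2 = pl_arc P r v"
    using pl_arc_is_arc[OF P] by blast
  have "path_image c1 \<inter> path_image c2 \<subseteq> {r}"
    using pl_arc_subset(1)[OF P] pl_arc_subset(1)[OF Q] PQ c1 c2 by blast
  then have "arc (c1 +++ c2)" using c1 c2 by (intro arc_join) auto
  then show ?thesis using that[of "c1 +++ c2"] c1 c2 by (simp add: path_image_join)
qed

text \<open>If the two arcs met in \<open>r\<close>, then the rays beyond \<open>r\<close> would both run outside the triangle
  \<open>u r v\<close>, hence on the same side of the bent arc from \<open>u\<close> over \<open>r\<close> to \<open>v\<close>; but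
  they end on different sides of it.\<close>

lemma nested_arcs_disjoint:
  fixes K :: "real \<Rightarrow> complex"
  defines "ou \<equiv> outside (path_image K)"
  assumes K: "simple_path K" "pathfinish K = pathstart K"
    and pl: "pseudoline L" "pseudoline P" "pseudoline Q" "pseudoline P'" "pseudoline Q'"
    and mem: "u \<in> L" "v \<in> L" "a \<in> P" "v \<in> P" "u \<in> Q" "b \<in> Q" "u \<in> Q'" "c \<in> Q'" "d \<in> P'" "v \<in> P'"
    and ne: "u \<noteq> v" "a \<noteq> v" "u \<noteq> b" "u \<noteq> c" "d \<noteq> v"
    and int: "P \<inter> L \<subseteq> {v}" "Q \<inter> L \<subseteq> {u}" "Q \<inter> Q' \<subseteq> {u}" "P \<inter> P' \<subseteq> {v}"
      "\<And>x y. x \<in> P \<inter> Q \<Longrightarrow> y \<in> P \<inter> Q \<Longrightarrow> x = y"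
    and vis: "pl_arc P a v \<inter> ou = {}" "pl_arc Q u b \<inter> ou = {}"
      "pl_arc Q' u c \<inter> ou = {}" "pl_arc P' d v \<inter> ou = {}"
    and il: "interleaved (path_image K) u v a b" "interleaved (path_image K) a b u c"
      "interleaved (path_image K) a b d v"
  shows "pl_arc P a v \<inter> pl_arc Q u b = {}"
proof (rule ccontr)
  assume "pl_arc P a v \<inter> pl_arc Q u b \<noteq> {}"
  then obtain r where r: "r \<in> pl_arc P a v" "r \<in> pl_arc Q u b" by auto
  note sP = pl_arc_subset[OF pl(2) mem(3,4) ne(2)] and sQ = pl_arc_subset[OF pl(3) mem(5,6) ne(3)]
  have rPQ: "r \<in> P" "r \<in> Q" using r sP sQ by auto
  have PQ: "P \<inter> Q \<subseteq> {r}" using int(5) rPQ by blast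
  have ru: "r \<noteq> u" "r \<noteq> v" using int(1,2) mem ne rPQ by blast+
  obtain K1 K2 where k: "closed K1" "closed K2" "K1 \<union> K2 = path_image K" "K1 \<inter> K2 = {u, v}"
    "a \<in> K1" "b \<in> K2" "a \<notin> {u, v}" "b \<notin> {u, v}" using il(1) unfolding interleaved_def by blast
  have ab: "a \<noteq> b" using k by blast
  note spP = pl_arc_split[OF pl(2) mem(3,4) ne(2) r(1)] and spQ = pl_arc_split[OF pl(3) mem(5,6) ne(3) r(2)]
  show False
  proof (cases "r = a \<or> r = b")
    case True
    then show False
    proof
      assume ra: "r = a"
      obtain g where g: "arc g" "pathstart g = a" "pathfinish g = b" "path_image g = pl_arc Q a b"
        using pl_arc_is_arc[OF pl(3) _ mem(6) ab] rPQ ra by blast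
      obtain g' where g': "arc g'" "path_image g' = pl_arc Q' u c"
        using pl_arc_is_arc[OF pl(5) mem(7,8) ne(4)] by blast
      have "path_image g \<inter> pl_arc Q' u c \<noteq> {}"
      proof (rule interleaved_arcs_meet[OF K il(2) g(1-3)])
        show "path_image g \<inter> outside (path_image K) = {}" using g(4) spQ(1) vis(2) ra by (auto simp: ou_def)
        show "connected (pl_arc Q' u c)" using g' connected_arc_image by metis
      qed (use pl_arc_subset[OF pl(5) mem(7,8) ne(4)] vis(3) in \<open>auto simp: ou_def\<close>)
      moreover have "pl_arc Q a b \<subseteq> Q" using spQ(1) sQ ra by auto
      ultimately have "u \<in> pl_arc Q a b"
        using g(4) int(3) pl_arc_subset[OF pl(5) mem(7,8) ne(4)] by blast
      moreover have "u \<in> pl_arc Q u a" using pl_arc_subset[OF pl(3) mem(5) rPQ(2)] ru ra by auto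
      ultimately show False using spQ(2) ra ru by auto
    next
      assume rb: "r = b"
      obtain g where g: "arc g" "pathstart g = a" "pathfinish g = b" "path_image g = pl_arc P a b"
        using pl_arc_is_arc[OF pl(2) mem(3) _ ab] rPQ rb by blast
      obtain g' where g': "arc g'" "path_image g' = pl_arc P' d v"
        using pl_arc_is_arc[OF pl(4) mem(9,10) ne(5)] by blast
      have "path_image g \<inter> pl_arc P' d v \<noteq> {}"
      proof (rule interleaved_arcs_meet[OF K il(3) g(1-3)])
        show "path_image g \<inter> outside (path_image K) = {}" using g(4) spP(1) vis(1) rb by (auto simp: ou_def)
        show "connected (pl_arc P' d v)" using g' connected_arc_image by metis
      qed (use pl_arc_subset[OF pl(4) mem(9,10) ne(5)] vis(4) in \<open>auto simp: ou_def\<close>)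
      moreover have "pl_arc P a b \<subseteq> P" using spP(1) sP rb by auto
      ultimately have "v \<in> pl_arc P a b"
        using g(4) int(4) pl_arc_subset[OF pl(4) mem(9,10) ne(5)] by blast
      moreover have "v \<in> pl_arc P b v" using pl_arc_subset[OF pl(2) rPQ(1) mem(4)] ru rb by auto
      ultimately show False using spP(2) rb ru by auto
    qed
  next
    case False
    then have rab: "r \<noteq> a" "r \<noteq> b" by auto
    obtain g where g: "arc g" "pathstart g = u" "pathfinish g = v" "path_image g = pl_arc Q u r \<union> pl_arc P r v"
      using bent_arc[OF pl(2) rPQ(1) mem(4) ru(2) pl(3) mem(5) rPQ(2) ru(1)[symmetric] PQ] by blast
    obtain s where s: "arc s" "path_image s = pl_arc L u v"
      using pl_arc_is_arc[OF pl(1) mem(1,2) ne(1)] by blast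
    let ?S = "pl_arc L u v"
    note sS = pl_arc_subset[OF pl(1) mem(1,2) ne(1)]
    have S: "compact ?S" "connected ?S" using s compact_arc_image connected_arc_image by metis+
    have rS: "r \<notin> ?S" using sS int(1) ru rPQ by blast
    let ?J = "path_image g \<union> ?S"
    have rP: "r \<in> pl_arc P v a" "pl_arc P r a = pl_arc P a r" "pl_arc P v r = pl_arc P r v"
      using r pl_arc_commute pl(2) mem rPQ by metis+
    obtain RX where RX: "connected RX" "\<not> bounded RX" "RX \<subseteq> P" "RX \<inter> pl_arc P v r = {}"
      "pl_arc P r a - {r} \<subseteq> RX" "connected (pl_arc P r a - {r})" "r \<in> closure (pl_arc P r a - {r})"
      by (rule pl_arc_ray[OF pl(2) mem(4,3) ne(2)[symmetric] rP(1) rab(1)])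
    obtain RY where RY: "connected RY" "\<not> bounded RY" "RY \<subseteq> Q" "RY \<inter> pl_arc Q u r = {}"
      "pl_arc Q r b - {r} \<subseteq> RY" "connected (pl_arc Q r b - {r})" "r \<in> closure (pl_arc Q r b - {r})"
      by (rule pl_arc_ray[OF pl(3) mem(5,6) ne(3) r(2) rab(2)])
    have e1: "r \<in> pl_arc P v r" "v \<in> pl_arc P v r" "r \<in> pl_arc Q u r" "u \<in> pl_arc Q u r"
      using pl_arc_subset[OF pl(2) mem(4) rPQ(1) ru(2)[symmetric]] pl_arc_subset[OF pl(3) mem(5) rPQ(2) ru(1)[symmetric]]
      by auto
    have sub1: "pl_arc Q u r \<subseteq> Q" "pl_arc P r v \<subseteq> P" using spP spQ sP sQ by auto
    \<comment> \<open>\<open>P\<close> meets the other two sides of the triangle at most in the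
      corners \<open>r\<close> and \<open>v\<close>, and these lie behind the ray. The same holds
      for \<open>Q\<close> with the corners \<open>r\<close> and \<open>u\<close>.\<close>
    have "RX \<inter> ?J = {}" unfolding g(4) using RX(3,4) e1 sub1 PQ sS(1) int(1) rP(3) by blast
    then have RXo: "RX \<subseteq> outside ?J" using RX unbounded_connected_subset_outside by blast
    have "RY \<inter> ?J = {}" unfolding g(4) using RY(3,4) e1 sub1 PQ sS(1) int(2) by blast
    then have RYo: "RY \<subseteq> outside ?J" using RY unbounded_connected_subset_outside by blast
    have Jb: "bounded ?J" using S g(1) by (simp add: compact_imp_bounded compact_arc_image)
    have cJ: "connected (outside ?J)" using Jb by (intro connected_outside) auto
    define X where "X = pl_arc P r a - {r}"
    define Y where "Y = pl_arc Q r b - {r}"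
    have Xg: "X \<inter> path_image g = {}" "Y \<inter> path_image g = {}"
      using RX(5) RY(5) RXo RYo outside_no_overlap[of ?J] unfolding X_def Y_def by blast+
    have XY: "X \<inter> ou = {}" "Y \<inter> ou = {}" using vis spP(1) spQ(1) rP by (auto simp: X_def Y_def)
    have "a \<in> pl_arc P r a" "b \<in> pl_arc Q r b"
      using pl_arc_subset(3)[OF pl(2) rPQ(1) mem(3) rab(1)] pl_arc_subset(3)[OF pl(3) rPQ(2) mem(6) rab(2)] by auto
    then have aX: "a \<in> X" "b \<in> Y" using rab by (auto simp: X_def Y_def)
    have near: "\<exists>x\<in>X. \<exists>y\<in>Y. connected_component (- (Ki \<union> path_image g)) x y"
      if Ki: "closed Ki" "r \<notin> Ki" for Ki
    proof -
      obtain e where e: "e > 0" "ball r e \<subseteq> - Ki" using Ki by (meson ComplI open_Compl open_contains_ball)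
      have "pathstart g \<in> ?S" "pathfinish g \<in> ?S" "r \<in> path_image g" using sS g e1 by auto
      from locally_connected_off_curve[OF g(1) S this rS e(1)] obtain d where d: "d > 0"
        "\<And>x y. x \<in> ball r d \<Longrightarrow> y \<in> ball r d \<Longrightarrow> connected_component (- ?J) x y \<Longrightarrow>
           connected_component (ball r e - ?J) x y" by blast
      obtain x where x: "x \<in> X" "dist x r < d" using RX(7) d(1) unfolding X_def closure_approachable by blast
      obtain y where y: "y \<in> Y" "dist y r < d" using RY(7) d(1) unfolding Y_def closure_approachable by blast
      have "x \<in> outside ?J" "y \<in> outside ?J" using x y RX(5) RY(5) RXo RYo by (auto simp: X_def Y_def)
      then have "connected_component (- ?J) x y"
        unfolding connected_component_def using cJ outside_no_overlap[of ?J] by blast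
      then have "connected_component (ball r e - ?J) x y" using d(2) x y by (simp add: dist_commute)
      then have "connected_component (- (Ki \<union> path_image g)) x y"
        by (rule connected_component_of_subset) (use e in blast)
      then show ?thesis using x y by blast
    qed
    \<comment> \<open>The arcs may meet on \<open>K\<close> itself. Then \<open>r\<close> lies on
      only one of the two pieces, since these share just \<open>u\<close> and \<open>v\<close>, and
      \<open>x\<close> and \<open>y\<close> can be joined near \<open>r\<close> away from the other
      piece. This is why \<open>chord_separates\<close> accepts a connection past either
      piece.\<close>
    have "\<exists>x\<in>X. \<exists>y\<in>Y. connected_component (- (K1 \<union> path_image g)) x y \<or>
        connected_component (- (K2 \<union> path_image g)) x y"
    proof (cases "r \<in> K1")
      case True
      then have "r \<notin> K2" using k(4) ru by blast
      then show ?thesis using near[OF k(2)] by blast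
    next
      case False
      then show ?thesis using near[OF k(1)] by blast
    qed
    then obtain x y where xy: "x \<in> X" "y \<in> Y" "connected_component (- (K1 \<union> path_image g)) x y \<or>
        connected_component (- (K2 \<union> path_image g)) x y" by blast
    have uvg: "K1 \<inter> K2 \<subseteq> path_image g" using k(4) g(2,3) by auto
    have cp: "connected (- path_image g)" using connected_arc_complement[OF g(1)] by simp
    have vg: "path_image g \<inter> outside (path_image K) = {}"
      using g(4) spP(1) spQ(1) vis by (auto simp: ou_def)
    show False
      by (rule chord_separates[OF K k(1-3) uvg compact_arc_image[OF g(1)] connected_arc_image[OF g(1)] cp vg,
            of X Y x y])
        (use RX(6) RY(6) Xg XY aX k xy in \<open>auto simp: X_def Y_def ou_def\<close>)
  qed
qed

section \<open>Filling a cross of visible arcs\<close>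

lemma inside_avoids_curve:
  fixes K :: "real \<Rightarrow> complex"
  assumes K: "simple_path K" "pathfinish K = pathstart K"
    and J: "closed J" "J \<inter> outside (path_image K) = {}"
  shows "inside J \<inter> (path_image K \<union> outside (path_image K)) = {}"
proof -
  note F = Jordan_facts[OF K]
  have o: "outside (path_image K) \<subseteq> outside J"
    using F(2,3) J(2) by (intro unbounded_connected_subset_outside) auto
  then have d: "inside J \<inter> outside (path_image K) = {}" using inside_Int_outside[of J] by blast
  \<comment> \<open>Each point of \<open>K\<close> is a limit of points outside \<open>K\<close>, so
    the open set \<open>inside J\<close> would contain some of these as well.\<close>
  have "z \<notin> inside J" if "z \<in> path_image K" for z
  proof
    assume "z \<in> inside J"
    moreover have "z \<in> closure (outside (path_image K))" using F(5) that by (auto simp: frontier_def)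
    ultimately show False
      using d open_Int_closure_eq_empty[OF open_inside[OF J(1)], of "outside (path_image K)"] by blast
  qed
  with d show ?thesis by blast
qed

text \<open>\<open>c2\<close> cuts the inside of \<open>c1 \<union> c3\<close> into two cells. The
  set \<open>E\<close> carries \<open>b\<close> from \<open>c2\<close> into this inside, the
  escaping set \<open>R\<close> keeps \<open>b\<close> off \<open>c2\<close> and out of the cell at
  \<open>c3\<close>, and the last hypothesis keeps it out of the cell at \<open>c1\<close>. No place
  is left for \<open>b\<close>.\<close>

lemma theta_trap:
  fixes c1 c2 c3 :: "real \<Rightarrow> complex"
  assumes arcs: "arc c1" "arc c2" "arc c3"
    and s: "pathstart c1 = u" "pathstart c2 = u" "pathstart c3 = u"
    and f: "pathfinish c1 = v" "pathfinish c2 = v" "pathfinish c3 = v" and "u \<noteq> v"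
    and I: "path_image c1 \<inter> path_image c2 = {u, v}" "path_image c1 \<inter> path_image c3 = {u, v}"
      "path_image c2 \<inter> path_image c3 = {u, v}"
    and m: "path_image c2 \<inter> inside (path_image c1 \<union> path_image c3) \<noteq> {}"
    and q: "q \<in> path_image c2" "q \<noteq> u" "q \<noteq> v"
    and E: "connected E" "q \<in> E" "b \<in> E" "E \<inter> (path_image c1 \<union> path_image c3) = {}"
    and R: "connected R" "\<not> bounded R" "b \<in> R" "R \<inter> (path_image c2 \<union> path_image c3) = {}"
    and b: "b \<notin> inside (path_image c1 \<union> path_image c2)"
  shows False
proof -
  let ?i = "inside (path_image c1 \<union> path_image c3)"
  have "connected (path_image c2 - {u, v})"
    using connected_simple_path_endless[of c2] arcs(2) s f by (simp add: arc_imp_simple_path)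
  then have "path_image c2 - {u, v} \<subseteq> ?i"
  proof (rule connected_disjoint_subset_inside)
    show "(path_image c2 - {u, v}) \<inter> (path_image c1 \<union> path_image c3) = {}" using I by blast
    obtain z where z: "z \<in> path_image c2" "z \<in> ?i" using m by blast
    then have "z \<notin> path_image c1" using inside_no_overlap[of "path_image c1 \<union> path_image c3"] by blast
    then have "z \<notin> {u, v}" unfolding I(1)[symmetric] by blast
    then show "(path_image c2 - {u, v}) \<inter> ?i \<noteq> {}" using z by blast
  qed
  then have "q \<in> ?i" using q by blast
  then have "E \<subseteq> ?i" using connected_disjoint_subset_inside[OF E(1,4)] E(2) by blast
  then have bi: "b \<in> ?i" using E by blast
  have "b \<in> outside (path_image c2 \<union> path_image c3)"
    using unbounded_connected_subset_outside[OF R(1,2,4)] R(3) by blast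
  then have bn: "b \<notin> inside (path_image c3 \<union> path_image c2)" "b \<notin> path_image c2"
    unfolding Un_commute[of "path_image c3" "path_image c2"]
    using inside_Int_outside[of "path_image c2 \<union> path_image c3"] R(3,4) by blast+
  have "inside (path_image c1 \<union> path_image c2) \<union> inside (path_image c3 \<union> path_image c2) \<union>
           (path_image c2 - {u, v}) = ?i"
    by (rule split_inside_simple_closed_curve[of c1 u v c3 c2])
      (use arcs s f I m \<open>u \<noteq> v\<close> in \<open>auto simp: arc_imp_simple_path Int_ac\<close>)
  then show False using bi bn b by blast
qed

text \<open>The form of \<open>theta_trap\<close> for a bent arc \<open>c2\<close>: it follows
  \<open>M\<close> from one end \<open>x\<close> (in the uses, \<open>u\<close> or \<open>v\<close>)
  to the bend \<open>q\<close>, where \<open>M\<close> leaves it and runs on to the vertex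
  \<open>y\<close>. The arc from \<open>q\<close> to \<open>y\<close> is the set \<open>E\<close>,
  the whole ray beyond \<open>q\<close> the set \<open>R\<close>.\<close>

lemma line_not_trapped:
  fixes c1 c2 c3 :: "real \<Rightarrow> complex"
  assumes arcs: "arc c1" "arc c2" "arc c3"
    and s: "pathstart c1 = u" "pathstart c2 = u" "pathstart c3 = u"
    and f: "pathfinish c1 = v" "pathfinish c2 = v" "pathfinish c3 = v" and uv: "u \<noteq> v"
    and I: "path_image c1 \<inter> path_image c2 = {u, v}" "path_image c1 \<inter> path_image c3 = {u, v}"
      "path_image c2 \<inter> path_image c3 = {u, v}"
    and m: "path_image c2 \<inter> inside (path_image c1 \<union> path_image c3) \<noteq> {}"
    and M: "pseudoline M" "x \<in> M" "y \<in> M" "x \<noteq> y" "q \<in> pl_arc M x y" "q \<noteq> y" "q \<noteq> x" "q \<noteq> u" "q \<noteq> v"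
    and c2: "path_image c2 = pl_arc M x q \<union> T" "M \<inter> T \<subseteq> {q}"
    and c1: "pl_arc M x y \<inter> path_image c1 \<subseteq> {x}" and c3: "M \<inter> path_image c3 \<subseteq> {x}"
    and y: "y \<notin> inside (path_image c1 \<union> path_image c2)"
  shows False
proof -
  obtain R where R: "connected R" "\<not> bounded R" "R \<subseteq> M" "R \<inter> pl_arc M x q = {}" "pl_arc M q y - {q} \<subseteq> R"
    by (rule pl_arc_ray[OF M(1-6)])
  have qM: "q \<in> M" using pl_arc_subset(1)[OF M(1-4)] M(5) by blast
  note s' = pl_arc_subset[OF M(1) qM M(3,6)] and s2 = pl_arc_subset[OF M(1,2) qM M(7)[symmetric]]
  note sp = pl_arc_split[OF M(1-5)]
  have "x \<notin> pl_arc M x q \<inter> pl_arc M q y" unfolding sp(2) using M(7) by simp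
  then have xq: "x \<notin> pl_arc M q y" using s2(2) by simp
  obtain e where e: "arc e" "path_image e = pl_arc M q y" using pl_arc_is_arc[OF M(1) qM M(3,6)] by blast
  have "pl_arc M q y \<inter> path_image c1 = {}" using c1 sp(1) xq by blast
  moreover have "pl_arc M q y \<inter> path_image c3 = {}" using c3 s'(1) xq by blast
  ultimately have E: "pl_arc M q y \<inter> (path_image c1 \<union> path_image c3) = {}" by blast
  have "R \<inter> T = {}" using R(3,4) c2(2) s2(3) by blast
  moreover have "R \<inter> path_image c3 = {}" using R(3,4) c3 s2(2) by blast
  ultimately have R2: "R \<inter> (path_image c2 \<union> path_image c3) = {}" unfolding c2(1) using R(4) by blast
  have q2: "q \<in> path_image c2" unfolding c2(1) using s2(3) by blast
  have yR: "y \<in> R" using R(5) s'(3) M(6) by blast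
  have cE: "connected (pl_arc M q y)" using e connected_arc_image by metis
  show False
    by (rule theta_trap[OF arcs s f uv I m q2 M(8,9) cE s'(2,3) E R(1,2) yR R2 y])
qed

text \<open>The points come in the cyclic order \<open>a1, u, a3, b1, v, b3\<close>.\<close>

lemma cross_fill:
  fixes K :: "real \<Rightarrow> complex"
  defines "ou \<equiv> outside (path_image K)"
  assumes K: "simple_path K" "pathfinish K = pathstart K"
    and pl: "pseudoline L" "pseudoline P1" "pseudoline P3" "pseudoline Q1" "pseudoline Q3"
    and mem: "u \<in> L" "v \<in> L" "a1 \<in> P1" "v \<in> P1" "a3 \<in> P3" "v \<in> P3" "u \<in> Q1" "b1 \<in> Q1" "u \<in> Q3" "b3 \<in> Q3"
    and KK: "u \<in> path_image K" "v \<in> path_image K" "a1 \<in> path_image K" "a3 \<in> path_image K"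
      "b1 \<in> path_image K" "b3 \<in> path_image K"
    and ne: "distinct [a1, u, a3, b1, v, b3]"
    and int: "P1 \<inter> L \<subseteq> {v}" "P3 \<inter> L \<subseteq> {v}" "Q1 \<inter> L \<subseteq> {u}" "Q3 \<inter> L \<subseteq> {u}"
      "Q1 \<inter> Q3 \<subseteq> {u}" "P1 \<inter> P3 \<subseteq> {v}"
      "\<And>x y. x \<in> P1 \<inter> Q1 \<Longrightarrow> y \<in> P1 \<inter> Q1 \<Longrightarrow> x = y"
      "\<And>x y. x \<in> P1 \<inter> Q3 \<Longrightarrow> y \<in> P1 \<inter> Q3 \<Longrightarrow> x = y"
      "\<And>x y. x \<in> P3 \<inter> Q1 \<Longrightarrow> y \<in> P3 \<inter> Q1 \<Longrightarrow> x = y"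
      "\<And>x y. x \<in> P3 \<inter> Q3 \<Longrightarrow> y \<in> P3 \<inter> Q3 \<Longrightarrow> x = y"
    and vis: "pl_arc P1 a1 v \<inter> ou = {}" "pl_arc P3 a3 v \<inter> ou = {}"
      "pl_arc Q1 u b1 \<inter> ou = {}" "pl_arc Q3 u b3 \<inter> ou = {}"
    and il: "interleaved (path_image K) u v a1 b1" "interleaved (path_image K) u v a3 b3"
      "interleaved (path_image K) a1 b1 u b3" "interleaved (path_image K) a1 b1 a3 v"
      "interleaved (path_image K) a3 b3 u b1" "interleaved (path_image K) a3 b3 a1 v"
      "interleaved (path_image K) a1 v u b3" "interleaved (path_image K) a3 v u b1"
  shows "pl_arc L u v \<inter> ou = {}"
proof -
  have n: "u \<noteq> v" "a1 \<noteq> v" "a3 \<noteq> v" "u \<noteq> b1" "u \<noteq> b3" using ne by auto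
  \<comment> \<open>\<open>d1\<close> and \<open>d3\<close> keep the mixed legs of the two bent arcs
    below apart; legs through the same vertex \<open>u\<close> or \<open>v\<close> meet only there.
    In each call the other two lines serve as the auxiliary \<open>Q'\<close> and
    \<open>P'\<close>.\<close>
  have d1: "pl_arc P1 a1 v \<inter> pl_arc Q1 u b1 = {}"
    by (rule nested_arcs_disjoint[OF K pl(1,2,4,3,5) mem(1-4,7-10,5,6) n(1,2,4,5,3) int(1,3,5,6,7)
          vis(1,3,4,2)[unfolded ou_def] il(1,3,4)])
  have d3: "pl_arc P3 a3 v \<inter> pl_arc Q3 u b3 = {}"
    by (rule nested_arcs_disjoint[OF K pl(1,3,5,2,4) mem(1,2,5,6,9,10,7,8,3,4) n(1,3,5,4,2) int(2,4) _ _ int(10)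
          vis(2,4,3,1)[unfolded ou_def] il(2,5,6)]) (use int(5,6) in auto)
  note sP1 = pl_arc_subset[OF pl(2) mem(3,4) n(2)] and sP3 = pl_arc_subset[OF pl(3) mem(5,6) n(3)]
    and sQ1 = pl_arc_subset[OF pl(4) mem(7,8) n(4)] and sQ3 = pl_arc_subset[OF pl(5) mem(9,10) n(5)]
    and sL = pl_arc_subset[OF pl(1) mem(1,2) n(1)]
  have conn: "connected (pl_arc M x y)" if "pseudoline M" "x \<in> M" "y \<in> M" "x \<noteq> y" for M x y
    using pl_arc_is_arc[OF that] connected_arc_image by metis
  obtain p where p: "p \<in> pl_arc P1 a1 v" "p \<in> pl_arc Q3 u b3"
  proof -
    obtain g where g: "arc g" "pathstart g = a1" "pathfinish g = v" "path_image g = pl_arc P1 a1 v"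
      using pl_arc_is_arc[OF pl(2) mem(3,4) n(2)] by blast
    have "path_image g \<inter> pl_arc Q3 u b3 \<noteq> {}"
      by (rule interleaved_arcs_meet[OF K il(7) g(1-3)])
        (use g(4) vis sQ3 conn[OF pl(5) mem(9,10) n(5)] in \<open>auto simp: ou_def\<close>)
    then show ?thesis using that g by auto
  qed
  obtain q where q: "q \<in> pl_arc P3 a3 v" "q \<in> pl_arc Q1 u b1"
  proof -
    obtain g where g: "arc g" "pathstart g = a3" "pathfinish g = v" "path_image g = pl_arc P3 a3 v"
      using pl_arc_is_arc[OF pl(3) mem(5,6) n(3)] by blast
    have "path_image g \<inter> pl_arc Q1 u b1 \<noteq> {}"
      by (rule interleaved_arcs_meet[OF K il(8) g(1-3)])
        (use g(4) vis sQ1 conn[OF pl(4) mem(7,8) n(4)] in \<open>auto simp: ou_def\<close>)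
    then show ?thesis using that g by auto
  qed
  have pm: "p \<in> P1" "p \<in> Q3" "q \<in> P3" "q \<in> Q1" using p q sP1 sP3 sQ1 sQ3 by blast+
  have pn: "p \<noteq> u" "p \<noteq> v" "q \<noteq> u" "q \<noteq> v" using pm int(1-4) mem n by blast+
  note un = pn[symmetric]
  have X1: "P1 \<inter> Q3 \<subseteq> {p}" "P3 \<inter> Q1 \<subseteq> {q}" using int(8,9) pm by blast+
  obtain \<alpha> where \<alpha>: "arc \<alpha>" "pathstart \<alpha> = u" "pathfinish \<alpha> = v" "path_image \<alpha> = pl_arc Q3 u p \<union> pl_arc P1 p v"
    using bent_arc[OF pl(2) pm(1) mem(4) pn(2) pl(5) mem(9) pm(2) un(1) X1(1)] by blast
  obtain \<beta> where \<beta>: "arc \<beta>" "pathstart \<beta> = u" "pathfinish \<beta> = v" "path_image \<beta> = pl_arc Q1 u q \<union> pl_arc P3 q v"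
    using bent_arc[OF pl(3) pm(3) mem(6) pn(4) pl(4) mem(7) pm(4) un(3) X1(2)] by blast
  obtain \<sigma> where \<sigma>: "arc \<sigma>" "pathstart \<sigma> = u" "pathfinish \<sigma> = v" "path_image \<sigma> = pl_arc L u v"
    using pl_arc_is_arc[OF pl(1) mem(1,2) n(1)] by blast
  note spP1 = pl_arc_split[OF pl(2) mem(3,4) n(2) p(1)] and spQ3 = pl_arc_split[OF pl(5) mem(9,10) n(5) p(2)]
  note spP3 = pl_arc_split[OF pl(3) mem(5,6) n(3) q(1)] and spQ1 = pl_arc_split[OF pl(4) mem(7,8) n(4) q(2)]
  have sub: "pl_arc Q3 u p \<subseteq> pl_arc Q3 u b3" "pl_arc P1 p v \<subseteq> pl_arc P1 a1 v"
    "pl_arc Q1 u q \<subseteq> pl_arc Q1 u b1" "pl_arc P3 q v \<subseteq> pl_arc P3 a3 v"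
    using spP1 spP3 spQ1 spQ3 by blast+
  have ends: "{u, v} \<subseteq> path_image \<alpha>" "{u, v} \<subseteq> path_image \<beta>" "{u, v} \<subseteq> path_image \<sigma>"
    using pathstart_in_path_image[of \<alpha>] pathfinish_in_path_image[of \<alpha>]
      pathstart_in_path_image[of \<beta>] pathfinish_in_path_image[of \<beta>]
      pathstart_in_path_image[of \<sigma>] pathfinish_in_path_image[of \<sigma>]
    unfolding \<alpha>(2,3) \<beta>(2,3) \<sigma>(2,3) by blast+
  have sub': "pl_arc Q3 u p \<subseteq> Q3" "pl_arc P1 p v \<subseteq> P1" "pl_arc Q1 u q \<subseteq> Q1" "pl_arc P3 q v \<subseteq> P3"
    using sub sP1 sP3 sQ1 sQ3 by blast+
  have I\<alpha>\<beta>: "path_image \<alpha> \<inter> path_image \<beta> = {u, v}"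
  proof
    have "pl_arc Q3 u p \<inter> pl_arc Q1 u q \<subseteq> {u, v}" "pl_arc P1 p v \<inter> pl_arc P3 q v \<subseteq> {u, v}"
      using sub' int(5,6) by blast+
    moreover have "pl_arc Q3 u p \<inter> pl_arc P3 q v \<subseteq> {u, v}" "pl_arc P1 p v \<inter> pl_arc Q1 u q \<subseteq> {u, v}"
      using sub d1 d3 by blast+
    ultimately show "path_image \<alpha> \<inter> path_image \<beta> \<subseteq> {u, v}" unfolding \<alpha>(4) \<beta>(4) by blast
  qed (use ends in blast)
  have I\<alpha>\<sigma>: "path_image \<alpha> \<inter> path_image \<sigma> = {u, v}"
  proof
    show "path_image \<alpha> \<inter> path_image \<sigma> \<subseteq> {u, v}" unfolding \<alpha>(4) \<sigma>(4)
      using sub' sL(1) int(1,4) by blast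
  qed (use ends in blast)
  have I\<beta>\<sigma>: "path_image \<beta> \<inter> path_image \<sigma> = {u, v}"
  proof
    show "path_image \<beta> \<inter> path_image \<sigma> \<subseteq> {u, v}" unfolding \<beta>(4) \<sigma>(4)
      using sub' sL(1) int(2,3) by blast
  qed (use ends in blast)
  have Jo: "(path_image \<alpha> \<union> path_image \<beta>) \<inter> ou = {}"
    unfolding \<alpha>(4) \<beta>(4) using sub vis by blast
  have Jc: "closed (path_image \<alpha> \<union> path_image \<beta>)" using \<alpha>(1) \<beta>(1) by (auto simp: closed_arc_image)
  note av = inside_avoids_curve[OF K Jc Jo[unfolded ou_def], folded ou_def]
  \<comment> \<open>From the bend \<open>q\<close> the line \<open>Q1\<close> runs on to
    \<open>b1\<close> without meeting \<alpha> or \<sigma>, so \<open>b1\<close> would be caught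
    inside these two. Yet as a point of \<open>K\<close> it is not between \<alpha> and \<beta>, and
    as a point of an escaping ray it is not between \<beta> and \<sigma>.\<close>
  have no\<beta>: "path_image \<beta> \<inter> inside (path_image \<alpha> \<union> path_image \<sigma>) = {}"
  proof (rule ccontr)
    assume m: "\<not> ?thesis"
    note trapped = line_not_trapped[OF \<alpha>(1) \<beta>(1) \<sigma>(1) \<alpha>(2) \<beta>(2) \<sigma>(2) \<alpha>(3) \<beta>(3) \<sigma>(3) n(1) I\<alpha>\<beta> I\<alpha>\<sigma> I\<beta>\<sigma> m]
    show False
    proof (cases "q = b1")
      case False
      show False
      proof (rule trapped[OF pl(4) mem(7,8) n(4) q(2) False pn(3,3,4) \<beta>(4)])
        show "Q1 \<inter> pl_arc P3 q v \<subseteq> {q}" using X1(2) sub'(4) by blast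
        have "pl_arc Q1 u b1 \<inter> pl_arc Q3 u p \<subseteq> {u}" using sQ1(1) sub'(1) int(5) by blast
        moreover have "pl_arc Q1 u b1 \<inter> pl_arc P1 p v = {}" using d1 sub(2) by blast
        ultimately show "pl_arc Q1 u b1 \<inter> path_image \<alpha> \<subseteq> {u}" unfolding \<alpha>(4) by blast
        show "Q1 \<inter> path_image \<sigma> \<subseteq> {u}" unfolding \<sigma>(4) using sL(1) int(3) by blast
        show "b1 \<notin> inside (path_image \<alpha> \<union> path_image \<beta>)" using av KK(5) by blast
      qed
    next
      \<comment> \<open>If the bend is the vertex \<open>b1\<close>, the visible arc on
        \<open>Q1\<close> ends there. Then \<beta> is followed from its other end \<open>v\<close>:
        it is \<open>P3\<close> that leaves it at \<open>q\<close> and runs on to \<open>a3\<close>,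
        a vertex different from \<open>b1\<close>.\<close>
      case True
      then have qa: "q \<noteq> a3" using ne by auto
      have cm: "pl_arc P3 v q = pl_arc P3 q v" "pl_arc P3 v a3 = pl_arc P3 a3 v"
        using pl_arc_commute[OF pl(3)] pm(3) mem(5,6) by blast+
      show False
      proof (rule trapped[OF pl(3) mem(6,5) n(3)[symmetric] _ qa pn(4,3,4)])
        show "q \<in> pl_arc P3 v a3" using q(1) cm(2) by simp
        show "path_image \<beta> = pl_arc P3 v q \<union> pl_arc Q1 u q" using \<beta>(4) cm(1) by blast
        show "P3 \<inter> pl_arc Q1 u q \<subseteq> {q}" using X1(2) sub'(3) by blast
        have "pl_arc P3 a3 v \<inter> pl_arc P1 p v \<subseteq> {v}" using sP3(1) sub'(2) int(6) by blast
        moreover have "pl_arc P3 a3 v \<inter> pl_arc Q3 u p = {}" using d3 sub(1) by blast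
        ultimately show "pl_arc P3 v a3 \<inter> path_image \<alpha> \<subseteq> {v}" unfolding \<alpha>(4) cm(2) by blast
        show "P3 \<inter> path_image \<sigma> \<subseteq> {v}" unfolding \<sigma>(4) using sL(1) int(2) by blast
        show "a3 \<notin> inside (path_image \<alpha> \<union> path_image \<beta>)" using av KK(4) by blast
      qed
    qed
  qed
  have no\<alpha>: "path_image \<alpha> \<inter> inside (path_image \<beta> \<union> path_image \<sigma>) = {}"
  proof (rule ccontr)
    assume m: "\<not> ?thesis"
    have I\<beta>\<alpha>: "path_image \<beta> \<inter> path_image \<alpha> = {u, v}" using I\<alpha>\<beta> by blast
    note trapped = line_not_trapped[OF \<beta>(1) \<alpha>(1) \<sigma>(1) \<beta>(2) \<alpha>(2) \<sigma>(2) \<beta>(3) \<alpha>(3) \<sigma>(3) n(1) I\<beta>\<alpha> I\<beta>\<sigma> I\<alpha>\<sigma> m]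
    show False
    proof (cases "p = b3")
      case False
      show False
      proof (rule trapped[OF pl(5) mem(9,10) n(5) p(2) False pn(1,1,2) \<alpha>(4)])
        show "Q3 \<inter> pl_arc P1 p v \<subseteq> {p}" using X1(1) sub'(2) by blast
        have "pl_arc Q3 u b3 \<inter> pl_arc Q1 u q \<subseteq> {u}" using sQ3(1) sub'(3) int(5) by blast
        moreover have "pl_arc Q3 u b3 \<inter> pl_arc P3 q v = {}" using d3 sub(4) by blast
        ultimately show "pl_arc Q3 u b3 \<inter> path_image \<beta> \<subseteq> {u}" unfolding \<beta>(4) by blast
        show "Q3 \<inter> path_image \<sigma> \<subseteq> {u}" unfolding \<sigma>(4) using sL(1) int(4) by blast
        show "b3 \<notin> inside (path_image \<beta> \<union> path_image \<alpha>)" using av KK(6) by (metis IntI UnI1 Un_commute empty_iff)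
      qed
    next
      case True
      then have qa: "p \<noteq> a1" using ne by auto
      have cm: "pl_arc P1 v p = pl_arc P1 p v" "pl_arc P1 v a1 = pl_arc P1 a1 v"
        using pl_arc_commute[OF pl(2)] pm(1) mem(3,4) by blast+
      show False
      proof (rule trapped[OF pl(2) mem(4,3) n(2)[symmetric] _ qa pn(2,1,2)])
        show "p \<in> pl_arc P1 v a1" using p(1) cm(2) by simp
        show "path_image \<alpha> = pl_arc P1 v p \<union> pl_arc Q3 u p" using \<alpha>(4) cm(1) by blast
        show "P1 \<inter> pl_arc Q3 u p \<subseteq> {p}" using X1(1) sub'(1) by blast
        have "pl_arc P1 a1 v \<inter> pl_arc P3 q v \<subseteq> {v}" using sP1(1) sub'(4) int(6) by blast
        moreover have "pl_arc P1 a1 v \<inter> pl_arc Q1 u q = {}" using d1 sub(3) by blast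
        ultimately show "pl_arc P1 v a1 \<inter> path_image \<beta> \<subseteq> {v}" unfolding \<beta>(4) cm(2) by blast
        show "P1 \<inter> path_image \<sigma> \<subseteq> {v}" unfolding \<sigma>(4) using sL(1) int(1) by blast
        show "a1 \<notin> inside (path_image \<beta> \<union> path_image \<alpha>)" using av KK(3) by (metis IntI UnI1 Un_commute empty_iff)
      qed
    qed
  qed
  have m: "path_image \<sigma> \<inter> inside (path_image \<alpha> \<union> path_image \<beta>) \<noteq> {}"
    using theta_inside[OF \<alpha>(1) \<beta>(1) \<sigma>(1) \<alpha>(2) \<beta>(2) \<sigma>(2) \<alpha>(3) \<beta>(3) \<sigma>(3) I\<alpha>\<beta> I\<alpha>\<sigma> I\<beta>\<sigma>] no\<alpha> no\<beta> by blast
  have "connected (path_image \<sigma> - {u, v})"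
    using connected_simple_path_endless[of \<sigma>] \<sigma> by (simp add: arc_imp_simple_path)
  then have "path_image \<sigma> - {u, v} \<subseteq> inside (path_image \<alpha> \<union> path_image \<beta>)"
  proof (rule connected_disjoint_subset_inside)
    show "(path_image \<sigma> - {u, v}) \<inter> (path_image \<alpha> \<union> path_image \<beta>) = {}" using I\<alpha>\<sigma> I\<beta>\<sigma> by blast
    obtain z where z: "z \<in> path_image \<sigma>" "z \<in> inside (path_image \<alpha> \<union> path_image \<beta>)" using m by blast
    then have "z \<notin> path_image \<alpha>" using inside_no_overlap[of "path_image \<alpha> \<union> path_image \<beta>"] by blast
    then have "z \<notin> {u, v}" using ends(1) by blast
    then show "(path_image \<sigma> - {u, v}) \<inter> inside (path_image \<alpha> \<union> path_image \<beta>) \<noteq> {}" using z by blast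
  qed
  moreover have "u \<notin> ou" "v \<notin> ou" using KK outside_no_overlap[of "path_image K"] unfolding ou_def by blast+
  ultimately show ?thesis using av \<sigma>(4) by blast
qed

section \<open>Crossings of horizontal and vertical segments\<close>

lemma card_le_if_charged:
  assumes "finite B" "\<And>z. z \<in> Z \<Longrightarrow> \<exists>k\<in>B. ch z k"
    and "\<And>z z' k. z \<in> Z \<Longrightarrow> z' \<in> Z \<Longrightarrow> ch z k \<Longrightarrow> ch z' k \<Longrightarrow> z = z'"
  shows "card Z \<le> card B"
proof -
  obtain f where f: "\<And>z. z \<in> Z \<Longrightarrow> f z \<in> B \<and> ch z (f z)" using assms(2) by metis
  have "inj_on f Z" using f assms(3) by (metis inj_onI)
  then show ?thesis using f assms(1) by (metis card_inj_on_le image_subsetI)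
qed

text \<open>Crossing pairs of horizontal segments (indexed by \<open>A\<close>) and vertical segments (indexed by
  \<open>B\<close>): \<open>R i\<close> and \<open>C j\<close> are the extents of the segments. Rows are numbered from top to bottom.\<close>

locale segment_crossings =
  fixes A :: "'a::linorder set" and B :: "'b::linorder set"
    and R :: "'a \<Rightarrow> 'b \<Rightarrow> bool" and C :: "'b \<Rightarrow> 'a \<Rightarrow> bool"
  assumes fin: "finite A" "finite B"
    and Rconv: "\<And>i j k l. i \<in> A \<Longrightarrow> R i j \<Longrightarrow> R i l \<Longrightarrow> j \<le> k \<Longrightarrow> k \<le> l \<Longrightarrow> R i k"
    and Cconv: "\<And>j i k l. j \<in> B \<Longrightarrow> C j i \<Longrightarrow> C j l \<Longrightarrow> i \<le> k \<Longrightarrow> k \<le> l \<Longrightarrow> C j k"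
begin

definition X :: "('a \<times> 'b) set" where
  "X = {(i, j). i \<in> A \<and> j \<in> B \<and> R i j \<and> C j i}"

definition row_next :: "'a \<Rightarrow> 'b \<Rightarrow> 'b \<Rightarrow> bool" where
  "row_next i j j' \<longleftrightarrow> (i, j) \<in> X \<and> (i, j') \<in> X \<and> j < j' \<and> (\<forall>k. j < k \<and> k < j' \<longrightarrow> (i, k) \<notin> X)"

definition col_next :: "'b \<Rightarrow> 'a \<Rightarrow> 'a \<Rightarrow> bool" where
  "col_next j i i' \<longleftrightarrow> (i, j) \<in> X \<and> (i', j) \<in> X \<and> i' < i \<and> (\<forall>k. i' < k \<and> k < i \<longrightarrow> (k, j) \<notin> X)"

text \<open>The lower left corner of an empty rectangular cell of the arrangement.\<close>

definition good :: "'a \<times> 'b \<Rightarrow> bool" where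
  "good p \<longleftrightarrow> (\<exists>j' i'. row_next (fst p) (snd p) j' \<and> row_next i' (snd p) j' \<and>
      col_next (snd p) (fst p) i' \<and> col_next j' (fst p) i')"

lemma finite_X: "finite X"
  by (rule finite_subset[of _ "A \<times> B"]) (auto simp: X_def fin)

lemma row_next_unique: "row_next i j j' \<Longrightarrow> row_next i j j'' \<Longrightarrow> j' = j''"
  unfolding row_next_def by (metis linorder_neqE)

lemma row_prev_unique: "row_next i j k \<Longrightarrow> row_next i j' k \<Longrightarrow> j = j'"
  unfolding row_next_def by (metis linorder_neqE)

lemma col_next_unique: "col_next j i i' \<Longrightarrow> col_next j i i'' \<Longrightarrow> i' = i''"
  unfolding col_next_def by (metis linorder_neqE)

lemma col_prev_unique: "col_next j i k \<Longrightarrow> col_next j i' k \<Longrightarrow> i = i'"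
  unfolding col_next_def by (metis linorder_neqE)

lemma row_next_exists:
  assumes "(i, j) \<in> X" "(i, k) \<in> X" "j < k"
  shows "\<exists>j'. row_next i j j'"
proof -
  let ?S = "{k. (i, k) \<in> X \<and> j < k}"
  have f: "finite ?S" by (rule finite_subset[of _ B]) (auto simp: X_def fin)
  have "Min ?S \<in> ?S" using assms f by (intro Min_in) auto
  moreover have "\<And>k. k \<in> ?S \<Longrightarrow> Min ?S \<le> k" using f by simp
  ultimately show ?thesis using assms unfolding row_next_def
    by (metis (mono_tags, lifting) linorder_not_le mem_Collect_eq)
qed

text \<open>Sliding the piece of row \<open>i\<close> between two neighbouring crossings upwards, the first obstacle met
  either closes an empty cell or contains the end of a segment, to which the piece is charged.\<close>

definition obstacle :: "'b \<Rightarrow> 'b \<Rightarrow> 'a \<Rightarrow> bool" where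
  "obstacle j j' k \<longleftrightarrow> k \<in> A \<and> (\<not> C j k \<or> \<not> C j' k \<or> (\<exists>l\<in>B. j < l \<and> l < j' \<and> C l k) \<or>
      (\<exists>l\<in>B. j \<le> l \<and> l \<le> j' \<and> R k l))"

definition first_obstacle :: "'a \<Rightarrow> 'b \<Rightarrow> 'b \<Rightarrow> 'a \<Rightarrow> bool" where
  "first_obstacle i j j' k \<longleftrightarrow> row_next i j j' \<and> k < i \<and> obstacle j j' k \<and>
     (\<forall>m. k < m \<and> m < i \<longrightarrow> \<not> obstacle j j' m)"

text \<open>Row numbers grow downwards, so the last condition says that column \<open>l\<close> has
  its lower end at row \<open>i'\<close>.\<close>

definition col_end :: "'a \<Rightarrow> 'b \<Rightarrow> 'b \<Rightarrow> bool" where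
  "col_end i j l \<longleftrightarrow> (\<exists>j' i'. first_obstacle i j j' i' \<and> l \<in> B \<and> j < l \<and> l < j' \<and> C l i' \<and>
      (\<forall>m\<in>A. C l m \<longrightarrow> m \<le> i'))"

text \<open>The ranges of \<open>l\<close> here and in \<open>left_end\<close> are half open on
  opposite sides: an end above a crossing shared by two neighbouring pieces is charged by only one
  of them.\<close>

definition right_end :: "'a \<Rightarrow> 'b \<Rightarrow> 'a \<Rightarrow> bool" where
  "right_end i j i' \<longleftrightarrow> (\<exists>j' l. first_obstacle i j j' i' \<and> l \<in> B \<and> j \<le> l \<and> l < j' \<and> R i' l \<and>
      (\<forall>m\<in>B. R i' m \<longrightarrow> m \<le> l))"

definition left_end :: "'a \<Rightarrow> 'b \<Rightarrow> 'a \<Rightarrow> bool" where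
  "left_end i j i' \<longleftrightarrow> (\<exists>j' l. first_obstacle i j j' i' \<and> l \<in> B \<and> j < l \<and> l \<le> j' \<and> R i' l \<and>
      (\<forall>m\<in>B. R i' m \<longrightarrow> l \<le> m))"

definition top_crossing :: "'a \<Rightarrow> 'b \<Rightarrow> bool" where
  "top_crossing i j \<longleftrightarrow> (i, j) \<in> X \<and> (\<forall>k. (k, j) \<in> X \<longrightarrow> i \<le> k)"

definition last_crossing :: "'a \<Rightarrow> 'b \<Rightarrow> bool" where
  "last_crossing i j \<longleftrightarrow> (i, j) \<in> X \<and> (\<forall>k. (i, k) \<in> X \<longrightarrow> k \<le> j)"

lemma row_between:
  assumes "row_next i j j'" "j \<le> l" "l \<le> j'"
  shows "R i l"
  using assms unfolding row_next_def X_def by (auto intro: Rconv)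

text \<open>Of two pieces in different rows below the same position \<open>l\<close>, the upper one
  would be an earlier obstacle for the lower one. Distinct pieces of one row overlap in at most an
  end, and this is what the last condition on \<open>l\<close> excludes.\<close>

lemma charged_unique:
  assumes fo: "first_obstacle i1 j1 j1' k" "first_obstacle i2 j2 j2' k"
    and l: "l \<in> B" "j1 \<le> l" "l \<le> j1'" "j2 \<le> l" "l \<le> j2'"
      "(l < j1' \<and> l < j2') \<or> (j1 < l \<and> j2 < l)"
  shows "(i1, j1) = (i2, j2)"
proof -
  note r1 = fo(1)[unfolded first_obstacle_def, THEN conjunct1]
  note r2 = fo(2)[unfolded first_obstacle_def, THEN conjunct1]
  have iA: "i1 \<in> A" "i2 \<in> A" using r1 r2 by (auto simp: row_next_def X_def)
  have R: "R i1 l" "R i2 l" using row_between r1 r2 l by auto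
  have "\<not> i1 < i2"
  proof
    assume "i1 < i2"
    then have "\<not> obstacle j2 j2' i1" using fo by (auto simp: first_obstacle_def)
    then show False using R l iA by (auto simp: obstacle_def)
  qed
  moreover have "\<not> i2 < i1"
  proof
    assume "i2 < i1"
    then have "\<not> obstacle j1 j1' i2" using fo by (auto simp: first_obstacle_def)
    then show False using R l iA by (auto simp: obstacle_def)
  qed
  ultimately have i: "i1 = i2" by auto
  have "j1 = j2"
  proof (rule ccontr)
    assume ne: "j1 \<noteq> j2"
    have x: "(i1, j1) \<in> X" "(i1, j2) \<in> X" using r1 r2 i by (auto simp: row_next_def)
    have "j1' \<le> j2 \<or> j2' \<le> j1" using ne x r1 r2 i unfolding row_next_def
      by (metis linorder_neqE linorder_not_le)
    then show False using l by auto
  qed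
  with i show ?thesis by simp
qed

text \<open>Let \<open>i'\<close> be the first obstacle. A bounding column that stops short of it
  has its top crossing in row \<open>i\<close>, since a crossing in between would be an earlier
  obstacle. An inner column present at \<open>i'\<close> must end there, since it neither crosses
  row \<open>i\<close> nor appears in the rows between. Otherwise row \<open>i'\<close> itself meets
  the strip: it spans it, which closes a good cell, or has an end in it.\<close>

lemma bad_cases:
  assumes p: "(i, j) \<in> X" and bad: "\<not> good (i, j)"
  shows "last_crossing i j \<or> top_crossing i j \<or> (\<exists>j'. row_next i j j' \<and> top_crossing i j') \<or>
    (\<exists>l. col_end i j l) \<or> (\<exists>i'. right_end i j i') \<or> (\<exists>i'. left_end i j i')"
proof (cases "last_crossing i j \<or> top_crossing i j")
  case False
  then obtain j' where j': "row_next i j j'" using row_next_exists[OF p] p by (force simp: last_crossing_def)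
  from False obtain i0 where i0: "(i0, j) \<in> X" "i0 < i" using p by (force simp: top_crossing_def)
  have i0o: "obstacle j j' i0" using i0 j' by (auto simp: obstacle_def X_def row_next_def)
  let ?S = "{k. k < i \<and> obstacle j j' k}"
  have f: "finite ?S" by (rule finite_subset[of _ A]) (auto simp: obstacle_def fin)
  define i' where "i' = Max ?S"
  have "i' \<in> ?S" unfolding i'_def using i0 i0o f by (intro Max_in) auto
  moreover have "k \<le> i'" if "k < i" "obstacle j j' k" for k unfolding i'_def using f that by simp
  ultimately have fo: "first_obstacle i j j' i'" using j' by (fastforce simp: first_obstacle_def)
  have mem: "i \<in> A" "j \<in> B" "j' \<in> B" "i' \<in> A" "i' < i" "j < j'" "C j i" "C j' i"
    "i' \<le> i" "j \<le> j'"
    using fo by (auto simp: first_obstacle_def row_next_def X_def obstacle_def)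
  have clear: "\<not> R m l \<and> C j m \<and> C j' m" if "m \<in> A" "i' < m" "m < i" "l \<in> B" "j \<le> l" "l \<le> j'" for m l
    using fo that by (auto simp: first_obstacle_def obstacle_def)
  have clear': "\<not> C l m" if "m \<in> A" "i' < m" "m < i" "l \<in> B" "j < l" "l < j'" for m l
    using fo that by (auto simp: first_obstacle_def obstacle_def)
  show ?thesis
  proof (cases "C j i' \<and> C j' i'")
    case nC: False
    have top: "i \<le> k" if "(k, c) \<in> X" "\<not> C c i'" "c = j \<or> c = j'" for k c
    proof (rule ccontr)
      assume "\<not> i \<le> k"
      then have "k < i" by simp
      have kc: "k \<in> A" "C c k" "R k c" using that by (auto simp: X_def)
      have "\<not> k \<le> i'" using Cconv[of c k i i'] that kc mem by auto
      then have "i' < k" by simp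
      then show False using clear[of k c] kc that mem \<open>k < i\<close> by auto
    qed
    have "top_crossing i j \<or> top_crossing i j'"
      using top nC p j' unfolding top_crossing_def row_next_def by blast
    then show ?thesis using j' by blast
  next
    case C: True
    show ?thesis
    proof (cases "\<exists>l\<in>B. j < l \<and> l < j' \<and> C l i'")
      case True
      then obtain l where l: "l \<in> B" "j < l" "l < j'" "C l i'" by auto
      have "m \<le> i'" if "m \<in> A" "C l m" for m
      proof (rule ccontr)
        assume "\<not> m \<le> i'"
        then have "i' < m" by simp
        have "(i, l) \<notin> X" using j' l by (auto simp: row_next_def)
        moreover have "R i l" using row_between[OF j'] l by simp
        ultimately have "\<not> C l i" using l mem by (auto simp: X_def)
        then have "m < i" using Cconv[of l i' m i] l that mem by (metis linorder_not_le order.strict_implies_order)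
        then show False using clear'[of m l] that l \<open>i' < m\<close> by auto
      qed
      then have "col_end i j l" unfolding col_end_def using fo l by blast
      then show ?thesis by blast
    next
      case noC: False
      then obtain l where l: "l \<in> B" "j \<le> l" "l \<le> j'" "R i' l"
        using fo C by (auto simp: first_obstacle_def obstacle_def)
      show ?thesis
      proof (cases "R i' j")
        case Rj: True
        show ?thesis
        proof (cases "R i' j'")
          case True
          have x: "(i', j) \<in> X" "(i', j') \<in> X" using Rj True C mem by (auto simp: X_def)
          have "row_next i' j j'" using x noC mem by (auto simp: row_next_def X_def)
          moreover have "col_next j i i'" "col_next j' i i'"
            using x p j' clear mem by (auto simp: col_next_def row_next_def) (auto simp: X_def)
          ultimately have "good (i, j)" using j' by (auto simp: good_def)
          with bad show ?thesis by simp
        next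
          case nR: False
          let ?T = "{m \<in> B. R i' m}"
          have fT: "finite ?T" using fin by simp
          have MT: "Max ?T \<in> ?T" using Rj mem fT by (intro Max_in) auto
          have "j \<le> Max ?T" using Rj mem fT by simp
          moreover have "Max ?T < j'"
            using Rconv[of i' j "Max ?T" j'] MT Rj nR mem by (metis (lifting) linorder_not_le mem_Collect_eq order.strict_implies_order)
          moreover have "\<forall>m\<in>B. R i' m \<longrightarrow> m \<le> Max ?T" using fT by simp
          ultimately have "right_end i j i'" unfolding right_end_def using fo MT by blast
          then show ?thesis by blast
        qed
      next
        case nR: False
        let ?T = "{m \<in> B. R i' m}"
        have fT: "finite ?T" using fin by simp
        have MT: "Min ?T \<in> ?T" using l fT by (intro Min_in) auto
        have "Min ?T \<le> l" using l fT by simp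
        then have "Min ?T \<le> j'" using l by simp
        moreover have "j < Min ?T"
        proof (rule ccontr)
          assume "\<not> j < Min ?T"
          then have "Min ?T \<le> j" by simp
          then show False using Rconv[of i' "Min ?T" l j] MT l nR mem by auto
        qed
        moreover have "\<forall>m\<in>B. R i' m \<longrightarrow> Min ?T \<le> m" using fT by simp
        ultimately have "left_end i j i'" unfolding left_end_def using fo MT by blast
        then show ?thesis by blast
      qed
    qed
  qed
qed auto

text \<open>Each of the six cases is charged injectively: last crossings, right ends and left ends
  to rows; top crossings, left neighbours of top crossings and lower column ends to columns. This
  gives three charges per segment.\<close>

lemma card_bad: "card {p \<in> X. \<not> good p} \<le> 3 * (card A + card B)"
proof -
  define Z1 where "Z1 = {(i, j). last_crossing i j}"
  define Z2 where "Z2 = {(i, j). top_crossing i j}"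
  define Z3 where "Z3 = {(i, j). \<exists>j'. row_next i j j' \<and> top_crossing i j'}"
  define Z4 where "Z4 = {(i, j). \<exists>l. col_end i j l}"
  define Z5 where "Z5 = {(i, j). \<exists>i'. right_end i j i'}"
  define Z6 where "Z6 = {(i, j). \<exists>i'. left_end i j i'}"
  note Zs = Z1_def Z2_def Z3_def Z4_def Z5_def Z6_def
  have sub: "{p \<in> X. \<not> good p} \<subseteq> Z1 \<union> Z2 \<union> Z3 \<union> Z4 \<union> Z5 \<union> Z6"
    unfolding Zs using bad_cases by auto
  have foX: "(i, j) \<in> X \<and> k \<in> A" if "first_obstacle i j j' k" for i j j' k
    using that by (auto simp: first_obstacle_def row_next_def obstacle_def)
  have ZX: "Z1 \<union> Z2 \<union> Z3 \<union> Z4 \<union> Z5 \<union> Z6 \<subseteq> X"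
    unfolding Zs last_crossing_def top_crossing_def row_next_def col_end_def right_end_def left_end_def
    using foX by blast
  have "card Z1 \<le> card A"
    by (rule card_le_if_charged[where ch = "\<lambda>z k. fst z = k"])
      (auto simp: fin Z1_def last_crossing_def X_def intro: antisym)
  moreover have "card Z2 \<le> card B"
    by (rule card_le_if_charged[where ch = "\<lambda>z k. snd z = k"])
      (auto simp: fin Z2_def top_crossing_def X_def intro: antisym)
  moreover have "card Z3 \<le> card B"
  proof (rule card_le_if_charged[where ch = "\<lambda>z k. row_next (fst z) (snd z) k \<and> top_crossing (fst z) k"])
    fix z assume "z \<in> Z3"
    then show "\<exists>k\<in>B. row_next (fst z) (snd z) k \<and> top_crossing (fst z) k"
      by (fastforce simp: Z3_def row_next_def X_def)
  next
    fix z z' k assume a: "row_next (fst z) (snd z) k \<and> top_crossing (fst z) k"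
      "row_next (fst z') (snd z') k \<and> top_crossing (fst z') k"
    then have "fst z = fst z'" unfolding top_crossing_def by (meson antisym)
    with a show "z = z'" by (metis prod.collapse row_prev_unique)
  qed (rule fin)
  moreover have "card Z4 \<le> card B"
  proof (rule card_le_if_charged[where ch = "\<lambda>z l. col_end (fst z) (snd z) l"])
    fix z assume "z \<in> Z4"
    then obtain l where "col_end (fst z) (snd z) l" by (auto simp: Z4_def)
    then show "\<exists>l\<in>B. col_end (fst z) (snd z) l" unfolding col_end_def by blast
  next
    fix z z' l assume "col_end (fst z) (snd z) l" "col_end (fst z') (snd z') l"
    then obtain j1 i1 j2 i2 where a: "l \<in> B" "first_obstacle (fst z) (snd z) j1 i1" "snd z < l" "l < j1"
      "C l i1" "\<forall>m\<in>A. C l m \<longrightarrow> m \<le> i1" "first_obstacle (fst z') (snd z') j2 i2" "snd z' < l" "l < j2"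
      "C l i2" "\<forall>m\<in>A. C l m \<longrightarrow> m \<le> i2" unfolding col_end_def by blast
    have "i1 \<in> A" "i2 \<in> A" using a foX by blast+
    then have "i1 = i2" using a(5,6,10,11) by (meson antisym)
    then have "(fst z, snd z) = (fst z', snd z')" using a by (intro charged_unique[of _ _ j1 i1 _ _ j2 l]) auto
    then show "z = z'" by simp
  qed (rule fin)
  moreover have "card Z5 \<le> card A"
  proof (rule card_le_if_charged[where ch = "\<lambda>z i'. right_end (fst z) (snd z) i'"])
    fix z assume "z \<in> Z5"
    then obtain i' where i': "right_end (fst z) (snd z) i'" by (auto simp: Z5_def)
    then have "i' \<in> A" unfolding right_end_def using foX by blast
    with i' show "\<exists>i'\<in>A. right_end (fst z) (snd z) i'" by blast
  next
    fix z z' i' assume "right_end (fst z) (snd z) i'" "right_end (fst z') (snd z') i'"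
    then obtain j1 l1 j2 l2 where a: "l1 \<in> B" "first_obstacle (fst z) (snd z) j1 i'" "snd z \<le> l1" "l1 < j1"
      "R i' l1" "\<forall>m\<in>B. R i' m \<longrightarrow> m \<le> l1" "l2 \<in> B" "first_obstacle (fst z') (snd z') j2 i'" "snd z' \<le> l2" "l2 < j2"
      "R i' l2" "\<forall>m\<in>B. R i' m \<longrightarrow> m \<le> l2" unfolding right_end_def by blast
    then have "l1 = l2" by (meson antisym)
    then have "(fst z, snd z) = (fst z', snd z')" using a by (intro charged_unique[of _ _ j1 i' _ _ j2 l1]) auto
    then show "z = z'" by simp
  qed (rule fin)
  moreover have "card Z6 \<le> card A"
  proof (rule card_le_if_charged[where ch = "\<lambda>z i'. left_end (fst z) (snd z) i'"])
    fix z assume "z \<in> Z6"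
    then obtain i' where i': "left_end (fst z) (snd z) i'" by (auto simp: Z6_def)
    then have "i' \<in> A" unfolding left_end_def using foX by blast
    with i' show "\<exists>i'\<in>A. left_end (fst z) (snd z) i'" by blast
  next
    fix z z' i' assume "left_end (fst z) (snd z) i'" "left_end (fst z') (snd z') i'"
    then obtain j1 l1 j2 l2 where a: "l1 \<in> B" "first_obstacle (fst z) (snd z) j1 i'" "snd z < l1" "l1 \<le> j1"
      "R i' l1" "\<forall>m\<in>B. R i' m \<longrightarrow> l1 \<le> m" "l2 \<in> B" "first_obstacle (fst z') (snd z') j2 i'" "snd z' < l2" "l2 \<le> j2"
      "R i' l2" "\<forall>m\<in>B. R i' m \<longrightarrow> l2 \<le> m" unfolding left_end_def by blast
    then have "l1 = l2" by (meson antisym)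
    then have "(fst z, snd z) = (fst z', snd z')" using a by (intro charged_unique[of _ _ j1 i' _ _ j2 l1]) auto
    then show "z = z'" by simp
  qed (rule fin)
  moreover have "card {p \<in> X. \<not> good p} \<le> card (Z1 \<union> Z2 \<union> Z3 \<union> Z4 \<union> Z5 \<union> Z6)"
    using sub by (intro card_mono finite_subset[OF ZX finite_X])
  moreover have "card (Z1 \<union> Z2 \<union> Z3 \<union> Z4 \<union> Z5 \<union> Z6) \<le> card Z1 + card Z2 + card Z3 + card Z4 + card Z5 + card Z6"
    by (intro order_trans[OF card_Un_le] add_mono order_refl)
  ultimately show ?thesis by presburger
qed

fun good_right :: "nat \<Rightarrow> 'a \<times> 'b \<Rightarrow> bool" where
  "good_right 0 p \<longleftrightarrow> p \<in> X"
| "good_right (Suc n) p \<longleftrightarrow> p \<in> X \<and> good p \<and> (\<exists>j'. row_next (fst p) (snd p) j' \<and> good_right n (fst p, j'))"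

text \<open>Runs of good crossings are required only at successive crossings of one column. That
  these runs use the same columns, so that the cells form a grid, follows from
  \<open>row_run_lift\<close>.\<close>

fun good_block :: "nat \<Rightarrow> nat \<Rightarrow> 'a \<times> 'b \<Rightarrow> bool" where
  "good_block n 0 p \<longleftrightarrow> p \<in> X"
| "good_block n (Suc m) p \<longleftrightarrow> good_right n p \<and> (\<exists>i'. col_next (snd p) (fst p) i' \<and> good_block n m (i', snd p))"

text \<open>A run fails because it starts at a bad crossing or because the shorter run from the next
  crossing fails. Passing to the next crossing is injective, so each additional step adds at most
  the number of bad crossings.\<close>

lemma card_not_good_right: "card {p \<in> X. \<not> good_right n p} \<le> n * card {p \<in> X. \<not> good p}"
proof (induction n)
  case (Suc n)
  let ?Y = "{p \<in> X. good p \<and> \<not> good_right (Suc n) p}"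
  have "card ?Y \<le> card {p \<in> X. \<not> good_right n p}"
  proof (rule card_le_if_charged[where ch = "\<lambda>z k. fst k = fst z \<and> row_next (fst z) (snd z) (snd k)"])
    show "finite {p \<in> X. \<not> good_right n p}" using finite_X by simp
  next
    fix z assume z: "z \<in> ?Y"
    then obtain j' where j': "row_next (fst z) (snd z) j'" by (auto simp: good_def)
    then have "(fst z, j') \<in> X" "\<not> good_right n (fst z, j')" using z by (auto simp: row_next_def)
    then show "\<exists>k\<in>{p \<in> X. \<not> good_right n p}. fst k = fst z \<and> row_next (fst z) (snd z) (snd k)"
      using j' by force
  next
    fix z z' k assume "fst k = fst z \<and> row_next (fst z) (snd z) (snd k)" "fst k = fst z' \<and> row_next (fst z') (snd z') (snd k)"
    then show "z = z'" by (metis prod.collapse row_prev_unique)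
  qed
  moreover have "{p \<in> X. \<not> good_right (Suc n) p} \<subseteq> ?Y \<union> {p \<in> X. \<not> good p}" by auto
  then have "card {p \<in> X. \<not> good_right (Suc n) p} \<le> card (?Y \<union> {p \<in> X. \<not> good p})"
    using finite_X by (intro card_mono) auto
  moreover have "card (?Y \<union> {p \<in> X. \<not> good p}) \<le> card ?Y + card {p \<in> X. \<not> good p}" by (rule card_Un_le)
  ultimately show ?case using Suc.IH by simp
qed simp

lemma card_not_good_block:
  assumes "n > 0"
  shows "card {p \<in> X. \<not> good_block n m p} \<le> m * card {p \<in> X. \<not> good_right n p}"
proof (induction m)
  case (Suc m)
  let ?Y = "{p \<in> X. good_right n p \<and> \<not> good_block n (Suc m) p}"
  have "card ?Y \<le> card {p \<in> X. \<not> good_block n m p}"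
  proof (rule card_le_if_charged[where ch = "\<lambda>z k. snd k = snd z \<and> col_next (snd z) (fst z) (fst k)"])
    show "finite {p \<in> X. \<not> good_block n m p}" using finite_X by simp
  next
    fix z assume z: "z \<in> ?Y"
    \<comment> \<open>This is where \<open>n > 0\<close> enters: a nonempty run starts at a good
      crossing, so there is a crossing above it in its column.\<close>
    then have "good z" using assms by (cases n) auto
    then obtain i' where i': "col_next (snd z) (fst z) i'" by (auto simp: good_def)
    then have "(i', snd z) \<in> X" "\<not> good_block n m (i', snd z)" using z by (auto simp: col_next_def)
    then show "\<exists>k\<in>{p \<in> X. \<not> good_block n m p}. snd k = snd z \<and> col_next (snd z) (fst z) (fst k)"
      using i' by force
  next
    fix z z' k assume "snd k = snd z \<and> col_next (snd z) (fst z) (fst k)" "snd k = snd z' \<and> col_next (snd z') (fst z') (fst k)"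
    then show "z = z'" by (metis prod.collapse col_prev_unique)
  qed
  moreover have "{p \<in> X. \<not> good_block n (Suc m) p} \<subseteq> ?Y \<union> {p \<in> X. \<not> good_right n p}" by auto
  then have "card {p \<in> X. \<not> good_block n (Suc m) p} \<le> card (?Y \<union> {p \<in> X. \<not> good_right n p})"
    using finite_X by (intro card_mono) auto
  moreover have "card (?Y \<union> {p \<in> X. \<not> good_right n p}) \<le> card ?Y + card {p \<in> X. \<not> good_right n p}" by (rule card_Un_le)
  ultimately show ?case using Suc.IH by simp
qed simp

fun row_run :: "nat \<Rightarrow> 'a \<Rightarrow> 'b \<Rightarrow> 'b set \<Rightarrow> bool" where
  "row_run 0 i j T \<longleftrightarrow> (i, j) \<in> X \<and> T = {j}"
| "row_run (Suc n) i j T \<longleftrightarrow> (\<exists>j' T'. row_next i j j' \<and> row_run n i j' T' \<and> T = insert j T')"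

lemma row_run_props:
  "row_run n i j T \<Longrightarrow> finite T \<and> card T = Suc n \<and> (\<forall>k\<in>T. j \<le> k \<and> (i, k) \<in> X)"
proof (induction n arbitrary: j T)
  case (Suc n)
  then obtain j' T' where a: "row_next i j j'" "row_run n i j' T'" "T = insert j T'" by auto
  have "j < j'" "(i, j) \<in> X" using a(1) by (auto simp: row_next_def)
  moreover from this Suc.IH[OF a(2)] have "j \<notin> T'" by auto
  ultimately show ?case using Suc.IH[OF a(2)] a(3) by fastforce
qed auto

lemma good_right_run: "good_right n (i, j) \<Longrightarrow> \<exists>T. row_run n i j T"
proof (induction n arbitrary: j)
  case (Suc n)
  then obtain j' where "row_next i j j'" "good_right n (i, j')" by auto
  with Suc.IH obtain T where "row_run n i j' T" by blast
  with \<open>row_next i j j'\<close> have "row_run (Suc n) i j (insert j T)" by auto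
  then show ?case by blast
qed auto

text \<open>The upper side of a good cell joins neighbouring crossings of row \<open>i'\<close> in
  the same two columns. Its right side says that \<open>i'\<close> is also the next crossing row
  above in column \<open>j'\<close>, which hands the claim on to the next cell.\<close>

lemma row_run_lift:
  "good_right n (i, j) \<Longrightarrow> row_run n i j T \<Longrightarrow> col_next j i i' \<Longrightarrow> row_run n i' j T"
proof (induction n arbitrary: j T)
  case 0
  then show ?case by (auto simp: col_next_def)
next
  case (Suc n)
  then obtain j' T' where a: "row_next i j j'" "row_run n i j' T'" "T = insert j T'" by auto
  from Suc.prems(1) obtain j3 where j3: "row_next i j j3" "good_right n (i, j3)" "good (i, j)" by auto
  then have gr: "good_right n (i, j')" and g: "good (i, j)" using row_next_unique[OF j3(1) a(1)] by auto
  from g obtain j2 i2 where g: "row_next i j j2" "row_next i2 j j2" "col_next j i i2" "col_next j2 i i2"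
    by (auto simp: good_def)
  have "j2 = j'" using row_next_unique[OF g(1) a(1)] .
  moreover have "i2 = i'" using col_next_unique[OF g(3) Suc.prems(3)] .
  ultimately show ?case using Suc.IH[OF gr a(2)] g a(3) by auto
qed

lemma good_block_grid:
  "good_block n m (i, j) \<Longrightarrow> row_run n i j T \<Longrightarrow>
    \<exists>S. finite S \<and> card S = Suc m \<and> (\<forall>k\<in>S. k \<le> i \<and> (\<forall>l\<in>T. (k, l) \<in> X))"
proof (induction m arbitrary: i)
  case 0
  then show ?case using row_run_props[OF 0(2)] by (intro exI[of _ "{i}"]) auto
next
  case (Suc m)
  then obtain i' where i': "col_next j i i'" "good_block n m (i', j)" "good_right n (i, j)" by auto
  from Suc.IH[OF i'(2) row_run_lift[OF i'(3) Suc.prems(2) i'(1)]]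
  obtain S where S: "finite S" "card S = Suc m" "\<forall>k\<in>S. k \<le> i' \<and> (\<forall>l\<in>T. (k, l) \<in> X)" by blast
  have "i' < i" using i'(1) by (simp add: col_next_def)
  then have "i \<notin> S" "\<forall>k\<in>S. k \<le> i" using S by force+
  then show ?case using S row_run_props[OF Suc.prems(2)] by (intro exI[of _ "insert i S"]) auto
qed

theorem card_crossings:
  assumes noK: "\<And>S T. S \<subseteq> A \<Longrightarrow> T \<subseteq> B \<Longrightarrow> card S = t \<Longrightarrow> card T = t \<Longrightarrow> \<exists>i\<in>S. \<exists>j\<in>T. (i, j) \<notin> X"
    and "t > 0"
  shows "card X \<le> 3 * t * t * (card A + card B)"
proof (rule ccontr)
  assume neg: "\<not> ?thesis"
  let ?b = "card {p \<in> X. \<not> good p}"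
  have "card {p \<in> X. \<not> good_block t t p} \<le> t * (t * ?b)"
    using card_not_good_block[OF \<open>t > 0\<close>, of t] card_not_good_right[of t]
    by (meson le_trans mult_le_mono2)
  also have "\<dots> \<le> t * (t * (3 * (card A + card B)))" using card_bad by (intro mult_le_mono2)
  also have "\<dots> < card X" using neg by (simp add: algebra_simps)
  finally have "{p \<in> X. \<not> good_block t t p} \<noteq> X" by auto
  then obtain i j where p: "(i, j) \<in> X" "good_block t t (i, j)" by auto
  have "good_right t (i, j)" using p(2) \<open>t > 0\<close> by (cases t) auto
  then obtain T where T: "row_run t i j T" using good_right_run by blast
  obtain S where S: "finite S" "card S = Suc t" "\<forall>k\<in>S. k \<le> i \<and> (\<forall>l\<in>T. (k, l) \<in> X)"
    using good_block_grid[OF p(2) T] by blast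
  have cT: "card T = Suc t" using row_run_props[OF T] by simp
  \<comment> \<open>A block of \<open>t\<close> by \<open>t\<close> cells is bounded by
    \<open>t + 1\<close> rows and columns, one more of each than required.\<close>
  obtain S' T' where ST: "S' \<subseteq> S" "card S' = t" "T' \<subseteq> T" "card T' = t"
    using obtain_subset_with_card_n[of t S] obtain_subset_with_card_n[of t T] S(2) cT by (metis le_SucI order_refl)
  have "S \<noteq> {}" "T \<noteq> {}" using S(2) cT by auto
  then have "S' \<subseteq> A" "T' \<subseteq> B" using S(3) ST by (fastforce simp: X_def)+
  then show False using noK[of S' T'] ST S(3) by blast
qed

end

section \<open>Visibility graphs\<close>

text \<open>The second piece of the curve runs through its starting point. As \<open>t < 1\<close>,
  the parameter 1 is not in the first piece, so the identification of \<open>K 0\<close> with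
  \<open>K 1\<close> creates no common point except \<open>K s\<close> in case
  \<open>s = 0\<close>.\<close>

lemma interleaved_params:
  fixes K :: "real \<Rightarrow> complex"
  assumes K: "simple_path K" "pathfinish K = pathstart K"
    and "0 \<le> s" "s < x" "x < t" "t < 1" "0 \<le> y" "y < 1" "y < s \<or> t < y"
  shows "interleaved (path_image K) (K s) (K t) (K x) (K y)"
proof -
  have eq: "a = b \<or> (a = 0 \<and> b = 1) \<or> (a = 1 \<and> b = 0)" if "a \<in> {0..1}" "b \<in> {0..1}" "K a = K b" for a b
    using K(1) that unfolding simple_path_def loop_free_def by blast
  have cont: "continuous_on {0..1} K" using K(1) by (simp add: simple_path_def path_def)
  have c: "closed (K ` T)" if "compact T" "T \<subseteq> {0..1}" for T
    using that cont by (meson compact_continuous_image compact_imp_closed continuous_on_subset)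
  let ?K1 = "K ` {s..t}" and ?K2 = "K ` ({0..s} \<union> {t..1})"
  show ?thesis unfolding interleaved_def
  proof (intro exI conjI)
    show "closed ?K1" "closed ?K2" using assms by (intro c; auto)+
    have "{s..t} \<union> ({0..s} \<union> {t..1}) = {0..1}" using assms by auto
    then show "?K1 \<union> ?K2 = path_image K" unfolding path_image_def image_Un[symmetric] by simp
    show "?K1 \<inter> ?K2 = {K s, K t}"
    proof
      show "?K1 \<inter> ?K2 \<subseteq> {K s, K t}"
      proof
        fix z assume "z \<in> ?K1 \<inter> ?K2"
        then obtain a b where ab: "a \<in> {s..t}" "b \<in> {0..s} \<union> {t..1}" "z = K a" "z = K b" by blast
        then have "a = b \<or> (a = 0 \<and> b = 1) \<or> (a = 1 \<and> b = 0)" using assms by (intro eq) auto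
        then have "a = s \<or> a = t" using ab assms by auto
        then show "z \<in> {K s, K t}" using ab by auto
      qed
    qed (use assms in auto)
    show "K x \<in> ?K1" using assms by auto
    show "K y \<in> ?K2" using assms by auto
    show "K x \<notin> {K s, K t}" "K y \<notin> {K s, K t}"
      using assms eq[of x s] eq[of x t] eq[of y s] eq[of y t] by auto
  qed
qed

lemma interleaved_swap: "interleaved K a b c d \<Longrightarrow> interleaved K a b d c"
  unfolding interleaved_def by (metis Int_commute Un_commute)

text \<open>The vertices are represented by their parameters \<open>W\<close> on the curve, so that their cyclic order,
  cut open at the start of the curve, is the order of the reals.\<close>

locale curve_visibility =
  fixes K :: "real \<Rightarrow> complex" and Ls :: "complex set set" and W :: "real set"
  assumes K: "simple_path K" "pathfinish K = pathstart K"
    and W: "finite W" "W \<subseteq> {0..<1}"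
    and lines: "\<And>L. L \<in> Ls \<Longrightarrow> pseudoline L"
    and meet: "\<And>L M x y. L \<in> Ls \<Longrightarrow> M \<in> Ls \<Longrightarrow> L \<noteq> M \<Longrightarrow> x \<in> L \<inter> M \<Longrightarrow> y \<in> L \<inter> M \<Longrightarrow> x = y"
    and joined: "\<And>x y. x \<in> W \<Longrightarrow> y \<in> W \<Longrightarrow> x \<noteq> y \<Longrightarrow> \<exists>L\<in>Ls. K x \<in> L \<and> K y \<in> L"
begin

definition adj :: "real \<Rightarrow> real \<Rightarrow> bool" where
  "adj x y \<longleftrightarrow> x \<in> W \<and> y \<in> W \<and> x \<noteq> y \<and>
     (\<exists>L\<in>Ls. K x \<in> L \<and> K y \<in> L \<and> pl_arc L (K x) (K y) \<inter> outside (path_image K) = {})"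

end

locale Ktt_free_visibility = curve_visibility +
  fixes t :: nat
  assumes t: "t > 0" and noK: "\<not> contains_Ktt adj W t"
begin

lemma inj_K: "inj_on K W"
proof (rule inj_onI)
  fix x y assume "x \<in> W" "y \<in> W" "K x = K y"
  moreover from this have "x \<in> {0..1}" "y \<in> {0..1}" "x \<noteq> 1" "y \<noteq> 1" using W by force+
  ultimately show "x = y" using K(1) unfolding simple_path_def loop_free_def by blast
qed

lemma adj_sym: "adj x y \<Longrightarrow> adj y x"
  unfolding adj_def using pl_arc_commute[OF lines] by metis

lemma adj_visible:
  assumes "adj x y" "L \<in> Ls" "K x \<in> L" "K y \<in> L"
  shows "pl_arc L (K x) (K y) \<inter> outside (path_image K) = {}"
proof -
  obtain M where M: "M \<in> Ls" "K x \<in> M" "K y \<in> M" "pl_arc M (K x) (K y) \<inter> outside (path_image K) = {}"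
    "x \<in> W" "y \<in> W" "x \<noteq> y"
    using assms unfolding adj_def by blast
  have "K x \<noteq> K y" using inj_K M by (auto dest: inj_onD)
  then have "M = L" using meet[OF M(1) assms(2), of "K x" "K y"] M assms by blast
  then show ?thesis using M by blast
qed

section \<open>Cliques on a pseudoline and neighbours off it\<close>

lemma clique_bound:
  assumes "X \<subseteq> W" "\<And>x y. x \<in> X \<Longrightarrow> y \<in> X \<Longrightarrow> x \<noteq> y \<Longrightarrow> adj x y"
  shows "card X < 2 * t"
proof (rule ccontr)
  assume "\<not> ?thesis"
  then have c: "2 * t \<le> card X" by simp
  have fX: "finite X" using assms W finite_subset by blast
  obtain S where S: "S \<subseteq> X" "card S = t" "finite S"
    using obtain_subset_with_card_n[of t X] c by auto
  have "t \<le> card (X - S)" using c S fX by (simp add: card_Diff_subset)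
  then obtain T where T: "T \<subseteq> X - S" "card T = t" using obtain_subset_with_card_n by blast
  have "contains_Ktt adj W t" unfolding contains_Ktt_def
    by (rule exI[of _ S], rule exI[of _ T]) (use S T assms in blast)
  with noK show False by simp
qed

text \<open>Of two neighbours on the same side of \<open>u\<close> along \<open>L\<close>, the
  farther one sees \<open>u\<close> past the nearer one, so they see each other. The neighbours on
  \<open>L\<close> thus form two cliques, each of size less than \<open>2 t\<close>.\<close>

lemma collinear_bound:
  assumes L: "L \<in> Ls" "K u \<in> L"
  shows "card {w. adj u w \<and> K w \<in> L} < 4 * t"
proof (cases "\<exists>w. adj u w \<and> K w \<in> L")
  case True
  then obtain w0 where w0: "adj u w0" "K w0 \<in> L" by blast
  then have "K u \<noteq> K w0" using inj_K by (auto simp: adj_def dest: inj_onD)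
  then obtain g h where gh: "homeomorphism (UNIV :: real set) L g h"
    using pseudoline_parametrization[OF lines[OF L(1)] L(2) w0(2)] by blast
  define k where "k = (\<lambda>w. h (K w))"
  let ?N = "{w. adj u w \<and> K w \<in> L}"
  have NW: "?N \<subseteq> W" by (auto simp: adj_def)
  have vis: "g ` closed_segment (k u) (k w) \<inter> outside (path_image K) = {}" if "w \<in> ?N" for w
    using adj_visible[of u w L] that L pl_arc_eq[OF gh L(2), of "K w"] by (simp add: k_def)
  have adjI: "adj x y" if "x \<in> ?N" "y \<in> ?N" "x \<noteq> y"
    "closed_segment (k x) (k y) \<subseteq> closed_segment (k u) (k x) \<union> closed_segment (k u) (k y)" for x y
  proof -
    have "pl_arc L (K x) (K y) = g ` closed_segment (k x) (k y)"
      using pl_arc_eq[OF gh] that by (simp add: k_def)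
    then have "pl_arc L (K x) (K y) \<inter> outside (path_image K) = {}"
      using vis[OF that(1)] vis[OF that(2)] that(4) by blast
    then show ?thesis using that NW L by (auto simp: adj_def)
  qed
  define N1 where "N1 = {w \<in> ?N. k u < k w}"
  define N2 where "N2 = {w \<in> ?N. k w < k u}"
  have c1: "card N1 < 2 * t"
  proof (rule clique_bound)
    show "N1 \<subseteq> W" using NW by (auto simp: N1_def)
    fix x y assume xy: "x \<in> N1" "y \<in> N1" "x \<noteq> y"
    then show "adj x y" by (intro adjI) (auto simp: N1_def closed_segment_eq_real_ivl)
  qed
  have c2: "card N2 < 2 * t"
  proof (rule clique_bound)
    show "N2 \<subseteq> W" using NW by (auto simp: N2_def)
    fix x y assume xy: "x \<in> N2" "y \<in> N2" "x \<noteq> y"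
    then show "adj x y" by (intro adjI) (auto simp: N2_def closed_segment_eq_real_ivl)
  qed
  have "k u \<noteq> k w" if "w \<in> ?N" for w
  proof
    assume "k u = k w"
    then have "g (h (K u)) = g (h (K w))" by (simp add: k_def)
    then have "K u = K w" using line_homeomorphismD(6)[OF gh] L(2) that by auto
    then show False using that inj_K by (auto simp: adj_def dest: inj_onD)
  qed
  then have "?N = N1 \<union> N2" unfolding N1_def N2_def by force
  then have "card ?N \<le> card N1 + card N2" by (metis card_Un_le)
  then show ?thesis using c1 c2 by linarith
next
  case False
  then have "{w. adj u w \<and> K w \<in> L} = {}" by blast
  then show ?thesis using t by (metis card.empty mult_pos_pos zero_less_numeral)
qed

lemma neighbour_off_line:
  assumes "4 * t \<le> card X" "\<And>w. w \<in> X \<Longrightarrow> adj u w" "L \<in> Ls" "K u \<in> L"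
  obtains w where "w \<in> X" "K w \<notin> L"
proof -
  have "\<not> X \<subseteq> {w. adj u w \<and> K w \<in> L}"
  proof
    assume "X \<subseteq> {w. adj u w \<and> K w \<in> L}"
    moreover have "finite {w. adj u w \<and> K w \<in> L}" using W by (auto simp: adj_def intro: finite_subset)
    ultimately have "card X \<le> card {w. adj u w \<and> K w \<in> L}" by (rule card_mono[rotated])
    then show False using collinear_bound[OF assms(3,4)] assms(1) by linarith
  qed
  then show ?thesis using that assms(2) by blast
qed

text \<open>Each line through \<open>u\<close> absorbs fewer than \<open>4 t\<close> neighbours; two
  lines to be avoided account for the number \<open>8 t\<close>.\<close>

lemma neighbour_off_two_lines:
  assumes X: "8 * t \<le> card X" "\<And>w. w \<in> X \<Longrightarrow> adj u w" and L: "L \<in> Ls" "K u \<in> L" "M \<in> Ls" "K u \<in> M"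
  obtains w where "w \<in> X" "K w \<notin> L" "K w \<notin> M"
proof -
  have fX: "finite X" using X(2) W by (meson adj_def finite_subset subsetI)
  have sub: "X \<inter> {w. adj u w \<and> K w \<in> L} \<subseteq> {w. adj u w \<and> K w \<in> L}" by blast
  have "finite {w. adj u w \<and> K w \<in> L}" using W by (auto simp: adj_def intro: finite_subset)
  then have "card (X \<inter> {w. adj u w \<and> K w \<in> L}) < 4 * t"
    using collinear_bound[OF L(1,2)] card_mono[OF _ sub] by linarith
  moreover have "card X = card (X \<inter> {w. adj u w \<and> K w \<in> L}) + card (X - {w. adj u w \<and> K w \<in> L})"
    using fX by (metis card_Int_Diff)
  ultimately have "4 * t \<le> card (X - {w. adj u w \<and> K w \<in> L})" using X(1) by linarith
  then obtain w where "w \<in> X - {w. adj u w \<and> K w \<in> L}" "K w \<notin> M"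
    using neighbour_off_line[of "X - {w. adj u w \<and> K w \<in> L}" u M] X(2) L by (metis DiffD1)
  then show ?thesis using that X(2) by blast
qed

lemma adj_fill:
  assumes AB: "A \<subseteq> W" "B \<subseteq> W" "\<And>x y. x \<in> A \<Longrightarrow> y \<in> B \<Longrightarrow> x < y" and ab: "a \<in> A" "b \<in> B"
    and rows: "8 * t \<le> card {y \<in> B. y < b \<and> adj a y}" "8 * t \<le> card {y \<in> B. b < y \<and> adj a y}"
    and cols: "8 * t \<le> card {x \<in> A. x < a \<and> adj x b}" "8 * t \<le> card {x \<in> A. a < x \<and> adj x b}"
  shows "adj a b"
proof -
  have W2: "a \<in> W" "b \<in> W" "a < b" using AB ab by auto
  then obtain L where L: "L \<in> Ls" "K a \<in> L" "K b \<in> L" using joined[of a b] by auto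
  \<comment> \<open>Each neighbour is chosen off \<open>L\<close>, and \<open>b1\<close> and
    \<open>a3\<close> also off the lines \<open>Q3\<close> and \<open>P1\<close> found just before.
    This makes the lines through \<open>K a\<close> distinct, and those through \<open>K b\<close>
    as well.\<close>
  obtain b3 where b3: "b3 \<in> {y \<in> B. b < y \<and> adj a y}" "K b3 \<notin> L"
    by (rule neighbour_off_line[of "{y \<in> B. b < y \<and> adj a y}" a L]) (use rows L in auto)
  then obtain Q3 where Q3: "Q3 \<in> Ls" "K a \<in> Q3" "K b3 \<in> Q3" by (auto simp: adj_def)
  obtain b1 where b1: "b1 \<in> {y \<in> B. y < b \<and> adj a y}" "K b1 \<notin> L" "K b1 \<notin> Q3"
    by (rule neighbour_off_two_lines[of "{y \<in> B. y < b \<and> adj a y}" a L Q3]) (use rows L Q3 in auto)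
  then obtain Q1 where Q1: "Q1 \<in> Ls" "K a \<in> Q1" "K b1 \<in> Q1" by (auto simp: adj_def)
  obtain a1 where a1: "a1 \<in> {x \<in> A. x < a \<and> adj x b}" "K a1 \<notin> L"
    by (rule neighbour_off_line[of "{x \<in> A. x < a \<and> adj x b}" b L]) (use cols L adj_sym in auto)
  then obtain P1 where P1: "P1 \<in> Ls" "K a1 \<in> P1" "K b \<in> P1" by (auto simp: adj_def)
  obtain a3 where a3: "a3 \<in> {x \<in> A. a < x \<and> adj x b}" "K a3 \<notin> L" "K a3 \<notin> P1"
    by (rule neighbour_off_two_lines[of "{x \<in> A. a < x \<and> adj x b}" b L P1]) (use cols L P1 adj_sym in auto)
  then obtain P3 where P3: "P3 \<in> Ls" "K a3 \<in> P3" "K b \<in> P3" by (auto simp: adj_def)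
  have ord: "a1 < a" "a < a3" "a3 < b1" "b1 < b" "b < b3" using a1 a3 b1 b3 AB by auto
  have mem: "a1 \<in> W" "a3 \<in> W" "b1 \<in> W" "b3 \<in> W" using a1 a3 b1 b3 AB by auto
  have r: "0 \<le> a1" "b3 < 1" using mem W by force+
  have ad: "adj a1 b" "adj a3 b" "adj a b1" "adj a b3" using a1 a3 b1 b3 by auto
  have nab: "K a \<noteq> K b" using inj_K W2 by (auto dest: inj_onD)
  have through: "M = L" if "M \<in> Ls" "K a \<in> M" "K b \<in> M" for M
    using meet[OF that(1) L(1), of "K a" "K b"] that L nab by blast
  have d: "L \<noteq> P1" "L \<noteq> P3" "L \<noteq> Q1" "L \<noteq> Q3" "Q1 \<noteq> Q3" "P1 \<noteq> P3"
    using a1 a3 b1 b3 P1 P3 Q1 Q3 by auto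
  \<comment> \<open>A line of both kinds would contain \<open>K a\<close> and \<open>K b\<close> and
    hence be \<open>L\<close>.\<close>
  have d': "P1 \<noteq> Q1" "P1 \<noteq> Q3" "P3 \<noteq> Q1" "P3 \<noteq> Q3"
    using through d P1 P3 Q1 Q3 by metis+
  have one: "M \<inter> N \<subseteq> {z}" if "M \<in> Ls" "N \<in> Ls" "M \<noteq> N" "z \<in> M" "z \<in> N" for M N z
    using meet[OF that(1-3)] that by blast
  have img: "K x \<in> path_image K" if "x \<in> W" for x using that W by (force simp: path_image_def)
  have "pl_arc L (K a) (K b) \<inter> outside (path_image K) = {}"
  proof (rule cross_fill[OF K lines[OF L(1)] lines[OF P1(1)] lines[OF P3(1)] lines[OF Q1(1)] lines[OF Q3(1)]
        L(2,3) P1(2,3) P3(2,3) Q1(2,3) Q3(2,3) img[OF W2(1)] img[OF W2(2)] img[OF mem(1)] img[OF mem(2)]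
        img[OF mem(3)] img[OF mem(4)]])
    have "distinct [a1, a, a3, b1, b, b3]" using ord by auto
    moreover have "set [a1, a, a3, b1, b, b3] \<subseteq> W" using W2 mem by auto
    ultimately have "distinct (map K [a1, a, a3, b1, b, b3])"
      unfolding distinct_map using inj_K inj_on_subset by blast
    then show "distinct [K a1, K a, K a3, K b1, K b, K b3]" by simp
    show "P1 \<inter> L \<subseteq> {K b}" "P3 \<inter> L \<subseteq> {K b}" "Q1 \<inter> L \<subseteq> {K a}" "Q3 \<inter> L \<subseteq> {K a}"
      "Q1 \<inter> Q3 \<subseteq> {K a}" "P1 \<inter> P3 \<subseteq> {K b}"
      using L P1 P3 Q1 Q3 d by (intro one; simp)+
    show "\<And>x y. x \<in> P1 \<inter> Q1 \<Longrightarrow> y \<in> P1 \<inter> Q1 \<Longrightarrow> x = y" by (rule meet[OF P1(1) Q1(1) d'(1)])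
    show "\<And>x y. x \<in> P1 \<inter> Q3 \<Longrightarrow> y \<in> P1 \<inter> Q3 \<Longrightarrow> x = y" by (rule meet[OF P1(1) Q3(1) d'(2)])
    show "\<And>x y. x \<in> P3 \<inter> Q1 \<Longrightarrow> y \<in> P3 \<inter> Q1 \<Longrightarrow> x = y" by (rule meet[OF P3(1) Q1(1) d'(3)])
    show "\<And>x y. x \<in> P3 \<inter> Q3 \<Longrightarrow> y \<in> P3 \<inter> Q3 \<Longrightarrow> x = y" by (rule meet[OF P3(1) Q3(1) d'(4)])
    show "pl_arc P1 (K a1) (K b) \<inter> outside (path_image K) = {}" by (rule adj_visible[OF ad(1) P1])
    show "pl_arc P3 (K a3) (K b) \<inter> outside (path_image K) = {}" by (rule adj_visible[OF ad(2) P3])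
    show "pl_arc Q1 (K a) (K b1) \<inter> outside (path_image K) = {}" by (rule adj_visible[OF ad(3) Q1])
    show "pl_arc Q3 (K a) (K b3) \<inter> outside (path_image K) = {}" by (rule adj_visible[OF ad(4) Q3])
    show "interleaved (path_image K) (K a) (K b) (K a3) (K b3)"
      "interleaved (path_image K) (K a1) (K b1) (K a) (K b3)"
      "interleaved (path_image K) (K a1) (K b1) (K a3) (K b)"
      "interleaved (path_image K) (K a1) (K b) (K a) (K b3)"
      using ord r by (intro interleaved_params[OF K]; linarith)+
    show "interleaved (path_image K) (K a) (K b) (K a1) (K b1)"
      "interleaved (path_image K) (K a3) (K b3) (K a) (K b1)"
      "interleaved (path_image K) (K a3) (K b3) (K a1) (K b)"
      "interleaved (path_image K) (K a3) (K b) (K a) (K b1)"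
      using ord r by (intro interleaved_swap[OF interleaved_params[OF K]]; linarith)+
  qed
  then show ?thesis using L W2 by (auto simp: adj_def)
qed

end

section \<open>Counting rows and columns, and splitting in halves\<close>

lemma card_few_below:
  fixes N :: "'a::linorder set"
  assumes "finite N"
  shows "card {b \<in> N. card {b' \<in> N. b' < b} < s} \<le> s"
proof (rule ccontr)
  define Y where "Y = {b \<in> N. card {b' \<in> N. b' < b} < s}"
  assume "\<not> ?thesis"
  then have c: "s < card Y" by (simp add: Y_def)
  have f: "finite Y" using assms by (simp add: Y_def)
  have ne: "Y \<noteq> {}" using c by auto
  have M: "Max Y \<in> Y" using f ne by (rule Max_in)
  \<comment> \<open>All other elements of \<open>Y\<close>, at least \<open>s\<close> in number, lie
    below the maximum, which contradicts that the maximum belongs to \<open>Y\<close>.\<close>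
  have "Y - {Max Y} \<subseteq> {b' \<in> N. b' < Max Y}"
    using f by (auto simp: Y_def) (metis (no_types, lifting) Max_ge Y_def f mem_Collect_eq order_le_imp_less_or_eq)
  then have "card (Y - {Max Y}) \<le> card {b' \<in> N. b' < Max Y}" using assms by (intro card_mono) auto
  moreover have "card (Y - {Max Y}) = card Y - 1" using M f by simp
  moreover have "card {b' \<in> N. b' < Max Y} < s" using M unfolding Y_def by blast
  ultimately show False using c by presburger
qed

lemma card_few_above:
  fixes N :: "'a::linorder set"
  assumes "finite N"
  shows "card {b \<in> N. card {b' \<in> N. b < b'} < s} \<le> s"
proof (rule ccontr)
  define Y where "Y = {b \<in> N. card {b' \<in> N. b < b'} < s}"
  assume "\<not> ?thesis"
  then have c: "s < card Y" by (simp add: Y_def)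
  have f: "finite Y" using assms by (simp add: Y_def)
  have ne: "Y \<noteq> {}" using c by auto
  have M: "Min Y \<in> Y" using f ne by (rule Min_in)
  have "Y - {Min Y} \<subseteq> {b' \<in> N. Min Y < b'}"
    using f by (auto simp: Y_def) (metis (no_types, lifting) Min_le Y_def f mem_Collect_eq order_le_imp_less_or_eq)
  then have "card (Y - {Min Y}) \<le> card {b' \<in> N. Min Y < b'}" using assms by (intro card_mono) auto
  moreover have "card (Y - {Min Y}) = card Y - 1" using M f by simp
  moreover have "card {b' \<in> N. Min Y < b'} < s" using M unfolding Y_def by blast
  ultimately show False using c by presburger
qed

lemma card_rows_le:
  assumes "finite A" "\<And>a. a \<in> A \<Longrightarrow> finite (F a)" "\<And>a. a \<in> A \<Longrightarrow> card (F a) \<le> s"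
  shows "card {(a, b). a \<in> A \<and> b \<in> F a} \<le> s * card A"
proof -
  have "{(a, b). a \<in> A \<and> b \<in> F a} = Sigma A F" by auto
  then have "card {(a, b). a \<in> A \<and> b \<in> F a} = (\<Sum>a\<in>A. card (F a))" using assms by (simp add: card_SigmaI)
  also have "\<dots> \<le> (\<Sum>a\<in>A. s)" using assms by (intro sum_mono)
  finally show ?thesis by (simp add: mult.commute)
qed

lemma card_columns_le:
  assumes "finite B" "\<And>b. b \<in> B \<Longrightarrow> finite (F b)" "\<And>b. b \<in> B \<Longrightarrow> card (F b) \<le> s"
  shows "card {(a, b). b \<in> B \<and> a \<in> F b} \<le> s * card B"
proof -
  have "{(a, b). b \<in> B \<and> a \<in> F b} = prod.swap ` {(b, a). b \<in> B \<and> a \<in> F b}" by auto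
  then have "card {(a, b). b \<in> B \<and> a \<in> F b} = card {(b, a). b \<in> B \<and> a \<in> F b}"
    by (simp add: card_image)
  also have "\<dots> \<le> s * card B" using card_rows_le[OF assms] .
  finally show ?thesis .
qed

lemma linear_split:
  fixes U :: "'a::linorder set"
  assumes "finite U" "k \<le> card U"
  shows "\<exists>A B. U = A \<union> B \<and> A \<inter> B = {} \<and> card A = k \<and> (\<forall>a\<in>A. \<forall>b\<in>B. a < b)"
  using assms(2)
proof (induction k)
  case 0
  then show ?case by (intro exI[of _ "{}"] exI[of _ U]) auto
next
  case (Suc k)
  then obtain A B where AB: "U = A \<union> B" "A \<inter> B = {}" "card A = k" "\<forall>a\<in>A. \<forall>b\<in>B. a < b" by auto
  have f: "finite A" "finite B" using AB assms by auto
  have "card U = k + card B" using AB f by (simp add: card_Un_disjoint)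
  then have "B \<noteq> {}" using Suc.prems by auto
  then have M: "Min B \<in> B" "\<And>b. b \<in> B \<Longrightarrow> Min B \<le> b" using f by auto
  then have "Min B \<notin> A" using AB by auto
  then show ?case using AB f M
    by (intro exI[of _ "insert (Min B) A"] exI[of _ "B - {Min B}"]) (auto simp: order_less_le)
qed

text \<open>Both parts have size at most \<open>2 n / 3\<close>, which is sharp for
  \<open>n = 3\<close>, so each logarithm drops by at least 1/3 because
  \<open>ln (2/3) <= 2/3 - 1\<close>.\<close>

lemma halving_inequality:
  fixes a b n :: nat
  assumes "n \<ge> 2" "a = n div 2" "b = n - a"
  shows "real a * ln (real a) + real b * ln (real b) + real n / 3 \<le> real n * ln (real n)"
proof -
  have ab: "a \<ge> 1" "b \<ge> 1" "a + b = n" "3 * a \<le> 2 * n" "3 * b \<le> 2 * n" using assms by auto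
  have le: "ln (real c) \<le> ln (real n) - 1/3" if "c \<ge> 1" "3 * c \<le> 2 * n" for c
  proof -
    have "real c \<le> real n * (2/3)" using that(2) by linarith
    then have "ln (real c) \<le> ln (real n * (2/3))" using that(1) by (subst ln_le_cancel_iff) (auto simp: assms)
    also have "\<dots> = ln (real n) + ln (2/3)" using assms by (intro ln_mult_pos) auto
    also have "ln (2/3 :: real) \<le> 2/3 - 1" by (rule ln_le_minus_one) simp
    finally show ?thesis by simp
  qed
  have "real a * ln (real a) \<le> real a * (ln (real n) - 1/3)" "real b * ln (real b) \<le> real b * (ln (real n) - 1/3)"
    using le ab by (auto intro!: mult_left_mono)
  then have "real a * ln (real a) + real b * ln (real b) \<le> (real a + real b) * (ln (real n) - 1/3)"
    unfolding distrib_right by (rule add_mono)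
  also have "real a + real b = real n" using ab by linarith
  finally show ?thesis by (simp add: algebra_simps)
qed

section \<open>Edge bounds for linearly ordered vertices\<close>

context Ktt_free_visibility
begin

text \<open>Twice \<open>8 t\<close> for the ones near the two ends of each row and column, plus the
  factor from \<open>card_crossings\<close>.\<close>

abbreviation bipartite_constant :: nat where
  "bipartite_constant \<equiv> 16 * t + 3 * t * t"

lemma bipartite_edges:
  assumes AB: "A \<subseteq> W" "B \<subseteq> W" "\<And>x y. x \<in> A \<Longrightarrow> y \<in> B \<Longrightarrow> x < y"
  shows "card {(a, b). a \<in> A \<and> b \<in> B \<and> adj a b} \<le> bipartite_constant * (card A + card B)"
proof -
  have fin: "finite A" "finite B" using AB W finite_subset by blast+
  define s where "s = 8 * t"
  define row where "row a = {b \<in> B. adj a b}" for a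
  define col where "col b = {a \<in> A. adj a b}" for b
  have frc: "finite (row a)" "finite (col b)" for a b using fin by (auto simp: row_def col_def)
  define R where "R a b \<longleftrightarrow> s \<le> card {y \<in> row a. y < b} \<and> s \<le> card {y \<in> row a. b < y}" for a b
  define C where "C b a \<longleftrightarrow> s \<le> card {x \<in> col b. x < a} \<and> s \<le> card {x \<in> col b. a < x}" for a b
  have mono: "card {y \<in> N. y < k} \<le> card {y \<in> N. y < l}" "card {y \<in> N. l < y} \<le> card {y \<in> N. k < y}"
    if "finite N" "k \<le> l" for N and k l :: real
    using that by (auto intro!: card_mono)
  interpret sc: segment_crossings A B R C
  proof
    fix i j k l assume "R i j" "R i l" "j \<le> k" "k \<le> l"
    then show "R i k" unfolding R_def using mono[OF frc(1)] by (meson le_trans)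
  next
    fix i j k l assume "C j i" "C j l" "i \<le> k" "k \<le> l"
    then show "C j k" unfolding C_def using mono[OF frc(2)] by (meson le_trans)
  qed (use fin in auto)
  have Xadj: "adj a b" if "(a, b) \<in> sc.X" for a b
  proof -
    have "a \<in> A" "b \<in> B" "R a b" "C b a" using that by (auto simp: sc.X_def)
    moreover have "{y \<in> row a. y < b} = {y \<in> B. y < b \<and> adj a y}" "{y \<in> row a. b < y} = {y \<in> B. b < y \<and> adj a y}"
      "{x \<in> col b. x < a} = {x \<in> A. x < a \<and> adj x b}" "{x \<in> col b. a < x} = {x \<in> A. a < x \<and> adj x b}"
      by (auto simp: row_def col_def)
    ultimately show ?thesis by (intro adj_fill[OF AB]) (auto simp: R_def C_def s_def)
  qed
  have dis: "A \<inter> B = {}" using AB(3) by force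
  have cX: "card sc.X \<le> 3 * t * t * (card A + card B)"
  proof (rule sc.card_crossings[OF _ t])
    fix S T assume ST: "S \<subseteq> A" "T \<subseteq> B" "card S = t" "card T = t"
    show "\<exists>i\<in>S. \<exists>j\<in>T. (i, j) \<notin> sc.X"
    proof (rule ccontr)
      assume "\<not> ?thesis"
      then have e: "\<forall>i\<in>S. \<forall>j\<in>T. adj i j" using Xadj by blast
      have sub: "S \<subseteq> W" "T \<subseteq> W" "S \<inter> T = {}" using ST(1,2) AB(1,2) dis by blast+
      have "contains_Ktt adj W t" unfolding contains_Ktt_def
        by (intro exI[of _ S] exI[of _ T] conjI sub ST(3,4) e)
      with noK show False by simp
    qed
  qed
  \<comment> \<open>The ones that are no crossings have fewer than \<open>s\<close> ones on one of
    their four sides, hence are among the \<open>s\<close> outermost ones at an end of their row or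
    column.\<close>
  define Z1 where "Z1 = {(a, b). a \<in> A \<and> b \<in> {b \<in> row a. card {y \<in> row a. y < b} < s}}"
  define Z2 where "Z2 = {(a, b). a \<in> A \<and> b \<in> {b \<in> row a. card {y \<in> row a. b < y} < s}}"
  define Z3 where "Z3 = {(a, b). b \<in> B \<and> a \<in> {a \<in> col b. card {x \<in> col b. x < a} < s}}"
  define Z4 where "Z4 = {(a, b). b \<in> B \<and> a \<in> {a \<in> col b. card {x \<in> col b. a < x} < s}}"
  have c: "card Z1 \<le> s * card A" "card Z2 \<le> s * card A" "card Z3 \<le> s * card B" "card Z4 \<le> s * card B"
    unfolding Z1_def Z2_def Z3_def Z4_def
    using fin frc card_few_below[OF frc(1)] card_few_above[OF frc(1)] card_few_below[OF frc(2)] card_few_above[OF frc(2)]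
    by (intro card_rows_le card_columns_le; simp)+
  have sub: "{(a, b). a \<in> A \<and> b \<in> B \<and> adj a b} \<subseteq> sc.X \<union> Z1 \<union> Z2 \<union> Z3 \<union> Z4"
    unfolding sc.X_def Z1_def Z2_def Z3_def Z4_def R_def C_def by (auto simp: row_def col_def)
  have "sc.X \<union> Z1 \<union> Z2 \<union> Z3 \<union> Z4 \<subseteq> A \<times> B"
    unfolding sc.X_def Z1_def Z2_def Z3_def Z4_def by (auto simp: row_def col_def)
  then have "finite (sc.X \<union> Z1 \<union> Z2 \<union> Z3 \<union> Z4)" using fin finite_subset by blast
  then have "card {(a, b). a \<in> A \<and> b \<in> B \<and> adj a b} \<le> card (sc.X \<union> Z1 \<union> Z2 \<union> Z3 \<union> Z4)"
    using sub by (rule card_mono)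
  also have "\<dots> \<le> card sc.X + card Z1 + card Z2 + card Z3 + card Z4"
    by (intro order_trans[OF card_Un_le] add_mono order_refl)
  also have "\<dots> \<le> 3 * t * t * (card A + card B) + s * card A + s * card A + s * card B + s * card B"
    using cX c by (intro add_mono)
  also have "\<dots> = bipartite_constant * (card A + card B)" by (simp add: s_def algebra_simps)
  finally show ?thesis .
qed

definition edges :: "real set \<Rightarrow> real set set" where
  "edges U = {{x, y} | x y. x \<in> U \<and> y \<in> U \<and> adj x y}"

lemma finite_edges: "finite U \<Longrightarrow> finite (edges U)"
  by (rule finite_subset[of _ "Pow U"]) (auto simp: edges_def)

lemma card_edges:
  assumes "U \<subseteq> W"
  shows "real (card (edges U)) \<le> 3 * real bipartite_constant * real (card U) * ln (real (card U))"
  using assms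
proof (induction "card U" arbitrary: U rule: less_induct)
  case less
  have fU: "finite U" using less.prems W finite_subset by blast
  show ?case
  proof (cases "card U \<ge> 2")
    case False
    have "edges U = {}"
    proof (rule ccontr)
      assume "edges U \<noteq> {}"
      then obtain x y where xy: "x \<in> U" "y \<in> U" "x \<noteq> y" by (auto simp: edges_def adj_def)
      then have "card {x, y} \<le> card U" using fU by (intro card_mono) auto
      then show False using False xy by simp
    qed
    \<comment> \<open>For a single vertex the logarithm vanishes; for none the first factor does,
      whatever the value of \<open>ln 0\<close>.\<close>
    moreover have "real (card U) * ln (real (card U)) = 0" using False by (cases "card U = 0") auto
    ultimately show ?thesis by auto
  next
    case True
    define n where "n = card U"
    obtain A B where AB: "U = A \<union> B" "A \<inter> B = {}" "card A = n div 2" "\<forall>a\<in>A. \<forall>b\<in>B. a < b"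
      using linear_split[OF fU, of "n div 2"] by (auto simp: n_def)
    have f: "finite A" "finite B" using fU AB by auto
    have cB: "card B = n - card A" using AB f by (simp add: n_def card_Un_disjoint)
    have lt: "card A < card U" "card B < card U" using True AB(3) cB by (auto simp: n_def)
    have AW: "A \<subseteq> W" "B \<subseteq> W" using less.prems AB by auto
    let ?c = "real bipartite_constant"
    let ?X = "{(a, b). a \<in> A \<and> b \<in> B \<and> adj a b}"
    have fX: "finite ?X" by (rule finite_subset[of _ "A \<times> B"]) (use f in auto)
    have "edges U \<subseteq> edges A \<union> edges B \<union> (\<lambda>(a, b). {a, b}) ` ?X"
    proof
      fix e assume "e \<in> edges U"
      then obtain x y where xy: "e = {x, y}" "x \<in> U" "y \<in> U" "adj x y" by (auto simp: edges_def)
      have yx: "adj y x" using xy adj_sym by blast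
      have eq: "e = {y, x}" using xy by auto
      consider "x \<in> A" "y \<in> A" | "x \<in> B" "y \<in> B" | "x \<in> A" "y \<in> B" | "x \<in> B" "y \<in> A" using xy AB by auto
      then show "e \<in> edges A \<union> edges B \<union> (\<lambda>(a, b). {a, b}) ` ?X"
      proof cases
        case 3
        then have "(x, y) \<in> ?X" using xy by auto
        then show ?thesis using xy(1) by (auto intro!: image_eqI[of _ _ "(x, y)"])
      next
        case 4
        then have "(y, x) \<in> ?X" using yx by auto
        then show ?thesis using eq by (auto intro!: image_eqI[of _ _ "(y, x)"])
      qed (use xy in \<open>auto simp: edges_def\<close>)
    qed
    then have "card (edges U) \<le> card (edges A \<union> edges B \<union> (\<lambda>(a, b). {a, b}) ` ?X)"
      using f fX by (intro card_mono) (auto simp: finite_edges)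
    also have "\<dots> \<le> card (edges A) + card (edges B) + card ((\<lambda>(a, b). {a, b}) ` ?X)"
      by (intro order_trans[OF card_Un_le] add_mono order_refl)
    also have "\<dots> \<le> card (edges A) + card (edges B) + bipartite_constant * (card A + card B)"
      by (intro add_left_mono order_trans[OF card_image_le[OF fX]] bipartite_edges[OF AW]) (use AB(4) in blast)
    also have "card A + card B = n" using cB lt(1) by (simp add: n_def)
    finally have "real (card (edges U)) \<le> real (card (edges A) + card (edges B) + bipartite_constant * n)"
      by (rule of_nat_mono)
    then have "real (card (edges U)) \<le> real (card (edges A)) + real (card (edges B)) + ?c * real n"
      by (simp only: of_nat_add of_nat_mult)
    also have "\<dots> \<le> 3 * ?c * real (card A) * ln (real (card A)) + 3 * ?c * real (card B) * ln (real (card B)) + ?c * real n"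
      using less.hyps[OF lt(1) AW(1)] less.hyps[OF lt(2) AW(2)] by linarith
    \<comment> \<open>The factor 3 in the bound turns the linear cost \<open>?c * n\<close> of the
      edges between the halves into the term \<open>n / 3\<close> that
      \<open>halving_inequality\<close> absorbs.\<close>
    also have "\<dots> = 3 * ?c * (real (card A) * ln (real (card A)) + real (card B) * ln (real (card B)) + real n / 3)"
      by (simp add: algebra_simps)
    also have "\<dots> \<le> 3 * ?c * (real n * ln (real n))"
      using halving_inequality[of n "card A" "card B"] True AB(3) cB by (intro mult_left_mono) (auto simp: n_def)
    finally show ?thesis by (simp add: n_def mult.assoc)
  qed
qed

end

section \<open>Cutting the cyclic order at a vertex\<close>

lemma curve_pos:
  assumes "simple_path K" "pathfinish K = pathstart K" "y \<in> path_image K"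
  shows "curve_pos K y \<in> {0..<1}" "K (curve_pos K y) = y"
proof -
  obtain s where s: "s \<in> {0..1}" "K s = y" using assms by (auto simp: path_image_def)
  have "\<exists>s. s \<in> {0..<1} \<and> K s = y"
  proof (cases "s = 1")
    case True
    then show ?thesis using s assms(2) by (intro exI[of _ 0]) (auto simp: pathstart_def pathfinish_def)
  qed (use s in auto)
  then have "curve_pos K y \<in> {0..<1} \<and> K (curve_pos K y) = y" unfolding curve_pos_def by (rule someI_ex)
  then show "curve_pos K y \<in> {0..<1}" "K (curve_pos K y) = y" by auto
qed

text \<open>The fractional parts by which \<open>cyc_less\<close> compares positions are the
  parameters on the curve restarted at the cut point, so a cyclic comparison becomes a comparison of
  reals.\<close>

lemma shiftpath_frac:
  assumes "pathfinish K = pathstart K" "p \<in> {0..<1}" "q \<in> {0..<1 :: real}"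
  shows "shiftpath p K (frac (q - p)) = K q"
proof (cases "p \<le> q")
  case True
  then have "frac (q - p) = q - p" using assms by (simp add: frac_eq)
  then show ?thesis using assms by (simp add: shiftpath_def)
next
  case False
  then have "\<lfloor>q - p\<rfloor> = -1" using assms by (intro floor_unique) auto
  then have "frac (q - p) = q - p + 1" by (simp add: frac_def)
  then show ?thesis using assms by (auto simp: shiftpath_def pathstart_def pathfinish_def)
qed

theorem theorem1p5:
  fixes t :: nat
  assumes "t > 0"
  shows "\<exists>C::real. \<forall>(K :: real \<Rightarrow> complex) (V :: complex set) (\<L> :: complex set set).
     jordan_curve K \<and> finite V \<and> card V \<ge> 2 \<and> V \<subseteq> path_image K \<and>
     pseudoline_family \<L> \<and>
     (\<forall>u\<in>V. \<forall>v\<in>V. u \<noteq> v \<longrightarrow> (\<exists>L\<in>\<L>. u \<in> L \<and> v \<in> L)) \<and>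
     \<not> contains_Ktt (cpv_adj \<L> K V) V t
     \<longrightarrow>
     real (num_edges (cpv_adj \<L> K V)) \<le> C * real (card V) * ln (real (card V)) \<and>
     (\<forall>A B. A \<subseteq> V \<and> B \<subseteq> V \<and> cyc_less K V A B \<longrightarrow>
        real (card {(a, b). a \<in> A \<and> b \<in> B \<and> cpv_adj \<L> K V a b})
          \<le> C * (real (card A) + real (card B)))"
proof (intro exI[of _ "3 * real (16 * t + 3 * t * t)"] allI impI, elim conjE)
  fix K :: "real \<Rightarrow> complex" and V :: "complex set" and \<L> :: "complex set set"
  assume J: "jordan_curve K" and V: "finite V" "card V \<ge> 2" "V \<subseteq> path_image K"
    and L: "pseudoline_family \<L>" and join: "\<forall>u\<in>V. \<forall>v\<in>V. u \<noteq> v \<longrightarrow> (\<exists>L\<in>\<L>. u \<in> L \<and> v \<in> L)"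
    and noK: "\<not> contains_Ktt (cpv_adj \<L> K V) V t"
  have K: "simple_path K" "pathfinish K = pathstart K" using J by (auto simp: jordan_curve_def)
  \<comment> \<open>For a cut at \<open>x\<close>, \<open>k x\<close> is the curve restarted at
    \<open>x\<close>, and \<open>f x y\<close> is the parameter of \<open>y\<close> on it. The image
    of the curve, and with it visibility, stays the same.\<close>
  define f where "f x y = frac (curve_pos K y - curve_pos K x)" for x y
  define k where "k x = shiftpath (curve_pos K x) K" for x
  have pos: "curve_pos K y \<in> {0..<1}" "K (curve_pos K y) = y" if "y \<in> V" for y
    using curve_pos[OF K] that V(3) by blast+
  have kf: "k x (f x y) = y" if "x \<in> V" "y \<in> V" for x y
    unfolding k_def f_def using shiftpath_frac[OF K(2) pos(1) pos(1)] pos(2) that by metis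
  have f01: "f x y \<in> {0..<1}" for x y by (simp add: f_def frac_ge_0 frac_lt_1)
  have kimg: "path_image (k x) = path_image K" if "x \<in> V" for x
    unfolding k_def using pos[OF that] K by (intro path_image_shiftpath) auto
  have inj: "inj_on (f x) V" if "x \<in> V" for x using kf[OF that] by (metis inj_onI)
  have vis: "Ktt_free_visibility (k x) \<L> (f x ` V) t" (is ?vis)
    and adj: "\<And>u v. u \<in> V \<Longrightarrow> v \<in> V \<Longrightarrow> curve_visibility.adj (k x) \<L> (f x ` V) (f x u) (f x v) \<longleftrightarrow> cpv_adj \<L> K V u v"
    if x: "x \<in> V" for x
  proof -
    interpret curve_visibility "k x" \<L> "f x ` V"
    proof
      show "simple_path (k x)" "pathfinish (k x) = pathstart (k x)"
        unfolding k_def using pos[OF x] K by (auto intro!: simple_path_shiftpath closed_shiftpath)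
      show "finite (f x ` V)" "f x ` V \<subseteq> {0..<1}" using V f01 by auto
      show "\<And>L. L \<in> \<L> \<Longrightarrow> pseudoline L" using L by (auto simp: pseudoline_family_def)
      show "\<And>L M a b. L \<in> \<L> \<Longrightarrow> M \<in> \<L> \<Longrightarrow> L \<noteq> M \<Longrightarrow> a \<in> L \<inter> M \<Longrightarrow> b \<in> L \<inter> M \<Longrightarrow> a = b"
        using L unfolding pseudoline_family_def by (metis singletonD)
      show "\<And>a b. a \<in> f x ` V \<Longrightarrow> b \<in> f x ` V \<Longrightarrow> a \<noteq> b \<Longrightarrow> \<exists>L\<in>\<L>. k x a \<in> L \<and> k x b \<in> L"
        using join kf[OF x] by force
    qed
    show a: "adj (f x u) (f x v) \<longleftrightarrow> cpv_adj \<L> K V u v" if "u \<in> V" "v \<in> V" for u v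
      unfolding adj_def cpv_adj_def using that kf[OF x] kimg[OF x] inj_on_eq_iff[OF inj[OF x]] by auto
    show ?vis
    proof
      show "t > 0" by fact
      show "\<not> contains_Ktt adj (f x ` V) t"
      proof
        assume "contains_Ktt adj (f x ` V) t"
        then obtain S T where ST: "S \<subseteq> f x ` V" "T \<subseteq> f x ` V" "S \<inter> T = {}" "card S = t" "card T = t"
          "\<forall>s\<in>S. \<forall>r\<in>T. adj s r" unfolding contains_Ktt_def by blast
        obtain S' T' where S': "S' \<subseteq> V" "S = f x ` S'" and T': "T' \<subseteq> V" "T = f x ` T'"
          using ST by (metis subset_imageE)
        have c: "card S' = t" "card T' = t"
          using ST(4,5) S' T' inj[OF x] by (metis card_image inj_on_subset)+
        have d: "S' \<inter> T' = {}" using ST(3) S' T' by blast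
        have e: "\<forall>s\<in>S'. \<forall>r\<in>T'. cpv_adj \<L> K V s r" using ST(6) S' T' a by blast
        have "contains_Ktt (cpv_adj \<L> K V) V t" unfolding contains_Ktt_def
          by (intro exI[of _ S'] exI[of _ T'] conjI S'(1) T'(1) c d e)
        with noK show False by simp
      qed
    qed
  qed
  have "V \<noteq> {}" using V(2) by auto
  \<comment> \<open>The total number of edges does not involve a cut, so any vertex serves
    here.\<close>
  then obtain x where x: "x \<in> V" by auto
  interpret vx: Ktt_free_visibility "k x" \<L> "f x ` V" t by (rule vis[OF x])
  have "{{u, v} | u v. cpv_adj \<L> K V u v} \<subseteq> (\<lambda>e. k x ` e) ` vx.edges (f x ` V)"
  proof
    fix e assume "e \<in> {{u, v} | u v. cpv_adj \<L> K V u v}"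
    then obtain u v where uv: "e = {u, v}" "cpv_adj \<L> K V u v" by blast
    then have V': "u \<in> V" "v \<in> V" by (auto simp: cpv_adj_def)
    then have "{f x u, f x v} \<in> vx.edges (f x ` V)" unfolding vx.edges_def using adj[OF x] uv by blast
    moreover have "e = k x ` {f x u, f x v}" using kf[OF x] V' uv by simp
    ultimately show "e \<in> (\<lambda>e. k x ` e) ` vx.edges (f x ` V)" by blast
  qed
  moreover have fe: "finite (vx.edges (f x ` V))" using V by (intro vx.finite_edges) auto
  ultimately have "num_edges (cpv_adj \<L> K V) \<le> card (vx.edges (f x ` V))"
    unfolding num_edges_def by (meson card_image_le card_mono finite_imageI le_trans)
  then have "real (num_edges (cpv_adj \<L> K V)) \<le> real (card (vx.edges (f x ` V)))" by simp
  also have "\<dots> \<le> 3 * real (16 * t + 3 * t * t) * real (card (f x ` V)) * ln (real (card (f x ` V)))"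
    by (rule vx.card_edges) simp
  also have "card (f x ` V) = card V" using inj[OF x] by (rule card_image)
  finally have 1: "real (num_edges (cpv_adj \<L> K V)) \<le> 3 * real (16 * t + 3 * t * t) * real (card V) * ln (real (card V))" .
  have 2: "real (card {(a, b). a \<in> A \<and> b \<in> B \<and> cpv_adj \<L> K V a b})
      \<le> 3 * real (16 * t + 3 * t * t) * (real (card A) + real (card B))"
    if AB: "A \<subseteq> V" "B \<subseteq> V" "cyc_less K V A B" for A B
  proof -
    \<comment> \<open>The cut must now be the one that witnesses \<open>A < B\<close>, so that all
      parameters of \<open>A\<close> precede those of \<open>B\<close>.\<close>
    obtain z where z: "z \<in> V" "\<forall>a\<in>A. \<forall>b\<in>B. f z a < f z b"
      using AB(3) unfolding cyc_less_def f_def by blast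
    interpret vz: Ktt_free_visibility "k z" \<L> "f z ` V" t by (rule vis[OF z(1)])
    let ?X = "{(a, b). a \<in> A \<and> b \<in> B \<and> cpv_adj \<L> K V a b}"
    let ?Y = "{(a, b). a \<in> f z ` A \<and> b \<in> f z ` B \<and> vz.adj a b}"
    have fin: "finite A" "finite B" using AB V finite_subset by blast+
    have "?X \<subseteq> (\<lambda>(a, b). (k z a, k z b)) ` ?Y"
    proof
      fix e assume "e \<in> ?X"
      then obtain a b where ab: "e = (a, b)" "a \<in> A" "b \<in> B" "cpv_adj \<L> K V a b" by blast
      then have V': "a \<in> V" "b \<in> V" using AB by auto
      then have "(f z a, f z b) \<in> ?Y" using adj[OF z(1)] ab by blast
      moreover have "e = (\<lambda>(a, b). (k z a, k z b)) (f z a, f z b)" using kf[OF z(1)] V' ab by simp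
      ultimately show "e \<in> (\<lambda>(a, b). (k z a, k z b)) ` ?Y" by (rule image_eqI[rotated])
    qed
    moreover have "finite ?Y" by (rule finite_subset[of _ "f z ` A \<times> f z ` B"]) (use fin in auto)
    ultimately have "card ?X \<le> card ?Y" by (meson card_image_le card_mono finite_imageI le_trans)
    also have "\<dots> \<le> (16 * t + 3 * t * t) * (card (f z ` A) + card (f z ` B))"
      using AB(1,2) z(2) by (intro vz.bipartite_edges) auto
    also have "\<dots> \<le> (16 * t + 3 * t * t) * (card A + card B)"
      using card_image_le fin by (intro mult_left_mono add_mono) auto
    finally have "real (card ?X) \<le> real ((16 * t + 3 * t * t) * (card A + card B))" by linarith
    also have "\<dots> \<le> 3 * real (16 * t + 3 * t * t) * (real (card A) + real (card B))"
      by (simp only: of_nat_mult of_nat_add[of "card A"]) (simp add: mult_right_mono)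
    finally show ?thesis .
  qed
  show "real (num_edges (cpv_adj \<L> K V)) \<le> 3 * real (16 * t + 3 * t * t) * real (card V) * ln (real (card V)) \<and>
     (\<forall>A B. A \<subseteq> V \<and> B \<subseteq> V \<and> cyc_less K V A B \<longrightarrow>
        real (card {(a, b). a \<in> A \<and> b \<in> B \<and> cpv_adj \<L> K V a b})
          \<le> 3 * real (16 * t + 3 * t * t) * (real (card A) + real (card B)))"
    using 1 2 by blast
qed

end
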